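(* Let $n\geqslant1$ be an integer, let $\{\psi,\Psi\}$ be a Battle-Lemarié system of order $n$, and let $1\leqslant p\leqslant\infty$. Let $B^{n+1,BL}_{p,\infty}(\mathbb{R})$ be the space of all $f\in\mathcal{S}_{n-1}'(\mathbb{R})$ such that $$\sup_{j\geqslant-1}2^{j\left(n+1-\frac1p\right)}\left(\sum_{\mu\in\mathbb{Z}}|\mathsf{k}_{j,\mu}(f)|^p\right)^{1/p}<\infty$$ (with a supremum over $\mu$ if $p=\infty$), equipped with this quantity. Then $W^{n+1}_p(\mathbb{R})\hookrightarrow B^{n+1,BL}_{p,\infty}(\mathbb{R})$ is a continuous embedding; that is, there is a constant $C=C(p,n,\psi,\Psi)>0$ such that the displayed quantity is at most $C\|f\|_{W^{n+1}_p(\mathbb{R})}$ for all $f \in W^{n+1}_p(\mathbb{R})$.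
   Context: $W^{k}_p(\mathbb{R})$ is the usual Sobolev space, normed for $k\in\mathbb{N}$ by $\|f\|_{L_p}+\|f^{(k)}\|_{L_p}$. For $r\in\mathbb{N}_0$, $\mathcal{S}_r$ is the space of real-valued $\varphi\in C^r(\mathbb{R})$ such that for all $k=0,\dots,r$ and all $\ell\in\mathbb{Z}$ there is $C_{\ell,k}>0$ with $|\varphi^{(k)}(x)|\leqslant C_{\ell,k}(1+|x|)^{-\ell}$ for all $x\in\mathbb{R}$, with convergence defined analogously to that in the Schwartz space; $\mathcal{S}_r'$ is its topological dual, and $(\cdot,\cdot)$ is the pairing between $\mathcal{S}_{n-1}'$ and $\mathcal{S}_{n-1}$. B-splines. $B_0=1_{[0,1)}$, $B_m=B_{m-1}*1_{[0,1)}$ for $m\geqslant1$. The multiresolution analysis of $L_2(\mathbb{R})$ generated by $B_m$: $V_0$ is the closed span in $L_2$ of the integer translates of $B_m$, $V_j=\{f(2^j\cdot):f\in V_0\}$, and $W_0$ is the orthogonal complement of $V_0$ in $V_1$. Battle-Lemarié system of order $n\geqslant 1$: a pair $\{\psi,\Psi\}$ of real-valued functions in $L_2(\mathbb{R})$ ($\Psi$ the scaling function, $\psi$ the wavelet) such that: (i) with $\psi_{j,\mu}(x)=\psi(2^jx-\mu)$ for $j\geqslant0$, $\psi_{-1,\mu}(x)=\sqrt2\,\Psi(x-\mu)$, $\mu\in\mathbb{Z}$, one has $(\psi_{j,\mu},\psi_{k,\nu})_{L_2}=2^{-j}\delta_{j,k}\delta_{\mu,\nu}$ for all $j,k\geqslant-1$,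 $\mu,\nu\in\mathbb{Z}$; (ii) (I) $\psi,\Psi\in C^{n-1}(\mathbb{R})$; (II) on each interval $(\mu,\mu+\frac12)$, $\mu\in\frac12\mathbb{Z}$, $\psi$ and $\Psi$ are polynomials of degree at most $n$; (III) there are $C_0,\gamma>0$ with $|\Psi^{(k)}(x)|+|\psi^{(k)}(x)|\leqslant C_0e^{-\gamma|x|}$ for $0\leqslant k\leqslant n-1$, $x\in\mathbb{R}$; (IV) $\int x^\kappa\psi(x)\,dx=0$ for $\kappa=0,\dots,n$; (iii) $\{\Psi(\cdot-\mu)\}_{\mu\in\mathbb{Z}}$ is an orthonormal basis of the space $V_0$ generated by $B_n$, and $\{\psi(\cdot-\mu)\}_{\mu\in\mathbb{Z}}$ is an orthonormal basis of the corresponding $W_0$. In particular $\psi,\Psi\in\mathcal{S}_{n-1}$. Shifted spline coefficients. $\widetilde\psi_{j,\mu}(x)=\psi(2^jx-\frac\mu2)$ for $j\geqslant0$, $\widetilde\psi_{-1,\mu}(x)=\Psi(x-\mu)$, $\mu\in\mathbb{Z}$; $\mathsf{k}_{j,\mu}(f)=2^j|(f,\widetilde\psi_{j,2\mu})|+2^j|(f,\widetilde\psi_{j,2\mu+1})|$ for $j\geqslant0$, and $\mathsf{k}_{-1,\mu}(f)=|(f,\widetilde\psi_{-1,\mu})|$. *)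

theory Defs
  imports "HOL-Analysis.Analysis" "HOL-Probability.Essential_Supremum"
begin

section \<open>Lebesgue spaces on the real line\<close>

text \<open>
  Elements of \<open>L\<^sub>p\<close> are represented by functions; functions that agree almost everywhere are not
  identified. The exponent is an extended nonnegative real, \<open>p = top\<close> being \<open>p = \<infinity>\<close>, so that
  \<open>enn2real (1 / p)\<close> is \<open>1/p\<close> with the usual convention \<open>1/\<infinity> = 0\<close>.
\<close>

definition ennreal_powr :: "ennreal \<Rightarrow> real \<Rightarrow> ennreal" where
  "ennreal_powr x a = (if x = top then top else ennreal (enn2real x powr a))"

definition Lp_norm :: "ennreal \<Rightarrow> (real \<Rightarrow> real) \<Rightarrow> ennreal" where
  "Lp_norm p f =
    (if p = top then esssup lebesgue (\<lambda>x. ennreal \<bar>f x\<bar>)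
     else ennreal_powr (\<integral>\<^sup>+x. ennreal (\<bar>f x\<bar> powr enn2real p) \<partial>lebesgue) (1 / enn2real p))"

definition Lp :: "ennreal \<Rightarrow> (real \<Rightarrow> real) set" where
  "Lp p = {f. f \<in> borel_measurable lebesgue \<and> Lp_norm p f < top}"

definition L2_inner :: "(real \<Rightarrow> real) \<Rightarrow> (real \<Rightarrow> real) \<Rightarrow> real" where
  "L2_inner f g = (LINT x|lebesgue. f x * g x)"

definition L2_closed_span :: "(int \<Rightarrow> real \<Rightarrow> real) \<Rightarrow> (real \<Rightarrow> real) set" where
  "L2_closed_span e =
    {f \<in> Lp 2. \<forall>\<epsilon>>0. \<exists>F c. finite F \<and> Lp_norm 2 (\<lambda>x. f x - (\<Sum>\<mu>\<in>F. c \<mu> * e \<mu> x)) < ennreal \<epsilon>}"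

definition L2_orthonormal_basis :: "(int \<Rightarrow> real \<Rightarrow> real) \<Rightarrow> (real \<Rightarrow> real) set \<Rightarrow> bool" where
  "L2_orthonormal_basis e V \<longleftrightarrow>
    (\<forall>\<mu>. e \<mu> \<in> V) \<and>
    (\<forall>\<mu> \<nu>. L2_inner (e \<mu>) (e \<nu>) = (if \<mu> = \<nu> then 1 else 0)) \<and>
    L2_closed_span e = V"


section \<open>Differentiability classes\<close>

definition C_class :: "nat \<Rightarrow> (real \<Rightarrow> real) set" where
  "C_class r =
    {f. (\<forall>k<r. \<forall>x. ((deriv ^^ k) f) field_differentiable (at x)) \<and>
        continuous_on UNIV ((deriv ^^ r) f)}"

definition test_functions :: "(real \<Rightarrow> real) set" where
  "test_functions = {\<phi>. (\<forall>k. \<phi> \<in> C_class k) \<and> compact (closure {x. \<phi> x \<noteq> 0})}"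


section \<open>Sobolev spaces\<close>

definition locally_integrable :: "(real \<Rightarrow> real) \<Rightarrow> bool" where
  "locally_integrable f \<longleftrightarrow> (\<forall>K. compact K \<longrightarrow> set_integrable lebesgue K f)"

definition has_weak_deriv :: "nat \<Rightarrow> (real \<Rightarrow> real) \<Rightarrow> (real \<Rightarrow> real) \<Rightarrow> bool" where
  "has_weak_deriv k f g \<longleftrightarrow>
    locally_integrable f \<and> locally_integrable g \<and>
    (\<forall>\<phi>\<in>test_functions.
      (LINT x|lebesgue. f x * (deriv ^^ k) \<phi> x) = (- 1) ^ k * (LINT x|lebesgue. g x * \<phi> x))"

text \<open>Weak derivatives are determined only up to null sets; the choice does not affect the norm.\<close>

definition weak_deriv :: "nat \<Rightarrow> (real \<Rightarrow> real) \<Rightarrow> (real \<Rightarrow> real)" where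
  "weak_deriv k f = (SOME g. has_weak_deriv k f g)"

definition sobolev :: "nat \<Rightarrow> ennreal \<Rightarrow> (real \<Rightarrow> real) set" where
  "sobolev k p = {f \<in> Lp p. \<forall>i\<le>k. \<exists>g\<in>Lp p. has_weak_deriv i f g}"

definition sobolev_norm :: "nat \<Rightarrow> ennreal \<Rightarrow> (real \<Rightarrow> real) \<Rightarrow> ennreal" where
  "sobolev_norm k p f = Lp_norm p f + Lp_norm p (weak_deriv k f)"


section \<open>The test spaces \<open>S\<^sub>r\<close> and their duals\<close>

definition S_space :: "nat \<Rightarrow> (real \<Rightarrow> real) set" where
  "S_space r =
    {\<phi> \<in> C_class r. \<forall>k\<le>r. \<forall>l::int. \<exists>C>0. \<forall>x. \<bar>(deriv ^^ k) \<phi> x\<bar> \<le> C * (1 + \<bar>x\<bar>) powi (- l)}"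

definition S_converges :: "nat \<Rightarrow> (nat \<Rightarrow> real \<Rightarrow> real) \<Rightarrow> (real \<Rightarrow> real) \<Rightarrow> bool" where
  "S_converges r \<Phi> \<phi> \<longleftrightarrow>
    (\<forall>k\<le>r. \<forall>l::int.
      uniform_limit UNIV (\<lambda>i x. (1 + \<bar>x\<bar>) powi l * (deriv ^^ k) (\<Phi> i) x)
        (\<lambda>x. (1 + \<bar>x\<bar>) powi l * (deriv ^^ k) \<phi> x) sequentially)"

text \<open>
  The topology of \<open>S\<^sub>r\<close> is given by countably many seminorms, so continuity of a functional is
  sequential continuity. Functionals are extensional, i.e. they carry no information outside
  \<open>S\<^sub>r\<close>.
\<close>

definition S_dual :: "nat \<Rightarrow> ((real \<Rightarrow> real) \<Rightarrow> real) set" where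
  "S_dual r =
    {\<Lambda> \<in> extensional (S_space r).
      (\<forall>\<phi>\<in>S_space r. \<forall>\<eta>\<in>S_space r. \<forall>a b.
        \<Lambda> (\<lambda>x. a * \<phi> x + b * \<eta> x) = a * \<Lambda> \<phi> + b * \<Lambda> \<eta>) \<and>
      (\<forall>\<Phi> \<phi>. (\<forall>i. \<Phi> i \<in> S_space r) \<and> \<phi> \<in> S_space r \<and> S_converges r \<Phi> \<phi> \<longrightarrow>
        (\<lambda>i. \<Lambda> (\<Phi> i)) \<longlonglongrightarrow> \<Lambda> \<phi>)}"

definition regular_distribution :: "nat \<Rightarrow> (real \<Rightarrow> real) \<Rightarrow> (real \<Rightarrow> real) \<Rightarrow> real" where
  "regular_distribution r f = (\<lambda>\<phi>\<in>S_space r. LINT x|lebesgue. f x * \<phi> x)"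


section \<open>B-splines and their multiresolution analysis\<close>

definition convolve :: "(real \<Rightarrow> real) \<Rightarrow> (real \<Rightarrow> real) \<Rightarrow> real \<Rightarrow> real" where
  "convolve f g x = (LINT y|lebesgue. f (x - y) * g y)"

primrec B_spline :: "nat \<Rightarrow> real \<Rightarrow> real" where
  "B_spline 0 = indicator {0..<1}"
| "B_spline (Suc m) = convolve (B_spline m) (indicator {0..<1})"

definition V_space :: "nat \<Rightarrow> int \<Rightarrow> (real \<Rightarrow> real) set" where
  "V_space m j =
    (\<lambda>f x. f (2 powi j * x)) ` L2_closed_span (\<lambda>\<mu> x. B_spline m (x - of_int \<mu>))"

definition W0_space :: "nat \<Rightarrow> (real \<Rightarrow> real) set" where
  "W0_space m = {f \<in> V_space m 1. \<forall>g\<in>V_space m 0. L2_inner f g = 0}"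


section \<open>Battle-Lemarie systems\<close>

definition wavelet_system ::
  "(real \<Rightarrow> real) \<Rightarrow> (real \<Rightarrow> real) \<Rightarrow> int \<Rightarrow> int \<Rightarrow> real \<Rightarrow> real" where
  "wavelet_system \<psi> \<Psi> j \<mu> x =
    (if j = - 1 then sqrt 2 * \<Psi> (x - of_int \<mu>) else \<psi> (2 powi j * x - of_int \<mu>))"

definition half_piecewise_poly :: "nat \<Rightarrow> (real \<Rightarrow> real) \<Rightarrow> bool" where
  "half_piecewise_poly n f \<longleftrightarrow>
    (\<forall>m::int. \<exists>q :: real poly. degree q \<le> n \<and>
      (\<forall>x\<in>{of_int m / 2 <..< of_int m / 2 + 1 / 2}. f x = poly q x))"

definition battle_lemarie_system :: "nat \<Rightarrow> (real \<Rightarrow> real) \<Rightarrow> (real \<Rightarrow> real) \<Rightarrow> bool" where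
  "battle_lemarie_system n \<psi> \<Psi> \<longleftrightarrow>
    \<psi> \<in> Lp 2 \<and> \<Psi> \<in> Lp 2 \<and>
    (\<forall>j\<ge>-1. \<forall>k\<ge>-1. \<forall>\<mu> \<nu>.
      L2_inner (wavelet_system \<psi> \<Psi> j \<mu>) (wavelet_system \<psi> \<Psi> k \<nu>) =
        (if j = k \<and> \<mu> = \<nu> then 2 powi (- j) else 0)) \<and>
    \<psi> \<in> C_class (n - 1) \<and> \<Psi> \<in> C_class (n - 1) \<and>
    half_piecewise_poly n \<psi> \<and> half_piecewise_poly n \<Psi> \<and>
    (\<exists>C0>0. \<exists>\<gamma>>0. \<forall>k\<le>n - 1. \<forall>x.
      \<bar>(deriv ^^ k) \<Psi> x\<bar> + \<bar>(deriv ^^ k) \<psi> x\<bar> \<le> C0 * exp (- \<gamma> * \<bar>x\<bar>)) \<and>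
    (\<forall>\<kappa>\<le>n. (LINT x|lebesgue. x ^ \<kappa> * \<psi> x) = 0) \<and>
    L2_orthonormal_basis (\<lambda>\<mu> x. \<Psi> (x - of_int \<mu>)) (V_space n 0) \<and>
    L2_orthonormal_basis (\<lambda>\<mu> x. \<psi> (x - of_int \<mu>)) (W0_space n)"


section \<open>Besov-type spaces of shifted spline coefficients\<close>

definition shifted_system ::
  "(real \<Rightarrow> real) \<Rightarrow> (real \<Rightarrow> real) \<Rightarrow> int \<Rightarrow> int \<Rightarrow> real \<Rightarrow> real" where
  "shifted_system \<psi> \<Psi> j \<mu> x =
    (if j = - 1 then \<Psi> (x - of_int \<mu>) else \<psi> (2 powi j * x - of_int \<mu> / 2))"

definition spline_coeff ::
  "(real \<Rightarrow> real) \<Rightarrow> (real \<Rightarrow> real) \<Rightarrow> ((real \<Rightarrow> real) \<Rightarrow> real) \<Rightarrow> int \<Rightarrow> int \<Rightarrow> real" where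
  "spline_coeff \<psi> \<Psi> \<Lambda> j \<mu> =
    (if j = - 1 then \<bar>\<Lambda> (shifted_system \<psi> \<Psi> j \<mu>)\<bar>
     else 2 powi j * \<bar>\<Lambda> (shifted_system \<psi> \<Psi> j (2 * \<mu>))\<bar>
        + 2 powi j * \<bar>\<Lambda> (shifted_system \<psi> \<Psi> j (2 * \<mu> + 1))\<bar>)"

definition lp_norm :: "ennreal \<Rightarrow> (int \<Rightarrow> real) \<Rightarrow> ennreal" where
  "lp_norm p a =
    (if p = top then (SUP \<mu>. ennreal \<bar>a \<mu>\<bar>)
     else ennreal_powr (\<Sum>\<^sub>\<infinity>\<mu>. ennreal (\<bar>a \<mu>\<bar> powr enn2real p)) (1 / enn2real p))"

definition BL_norm ::
  "nat \<Rightarrow> ennreal \<Rightarrow> (real \<Rightarrow> real) \<Rightarrow> (real \<Rightarrow> real) \<Rightarrow> ((real \<Rightarrow> real) \<Rightarrow> real) \<Rightarrow> ennreal" where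
  "BL_norm n p \<psi> \<Psi> \<Lambda> =
    (SUP j\<in>{-1::int..}.
      ennreal (2 powr (of_int j * (real n + 1 - enn2real (1 / p)))) *
      lp_norm p (spline_coeff \<psi> \<Psi> \<Lambda> j))"

definition BL_space ::
  "nat \<Rightarrow> ennreal \<Rightarrow> (real \<Rightarrow> real) \<Rightarrow> (real \<Rightarrow> real) \<Rightarrow> ((real \<Rightarrow> real) \<Rightarrow> real) set" where
  "BL_space n p \<psi> \<Psi> = {\<Lambda> \<in> S_dual (n - 1). BL_norm n p \<psi> \<Psi> \<Lambda> < top}"

end

(*
  Vanishing moments give \<psi> an (n+1)-fold antiderivative \<theta> with exponential decay, so that integrating by
  parts n+1 times turns the coefficient of f against \<psi>(2^j x - c) into 2^(-j(n+1)) times that of the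
  weak derivative of order n+1 against \<theta>(2^j x - c). The lp-norm over the translates of such averages is
  then controlled by a Hoelder estimate, since sum_mu exp(-\<gamma> |y - mu|) is bounded uniformly in y.

  Integration by parts against a C^1 function of non-compact support follows from the definition
  through test functions of the form polynomial times exp(-1/(1 - (x/R)^2)): for fixed R the
  Weierstrass theorem yields it for the bump times any C^1 function, and then R tends to infinity.
*)

theory Submission
  imports Defs "HOL-Probability.Sinc_Integral"
begin

section \<open>Smooth bumps and polynomial approximation\<close>

text \<open>Weak derivatives are tested with smooth compactly supported functions only, whereas the
  antiderivatives of \<psi> have limited smoothness: for n = 1 the first one is merely C^1. A family
  of bumps that is stable under differentiation and under multiplication by polynomials bridges this
  gap without mollifiers. The powers of a = 2^j balance as follows. The factor 2^j in the
  coefficients gives the kernels exp(-\<gamma> |a x - \<mu>|) a mass independent of j and \<mu>.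
  Summing p-th powers over \<mu> then produces a^(1/p), which, multiplied by the gain from the
  integrations by parts, exactly offsets the weight 2^(j(n+1-1/p)). The level j = -1 has no moments
  to exploit and is bounded by the norm of f itself. The half-integer shifts are moved to integers
  at the cost of a constant factor.\<close>

definition flat :: "real poly \<Rightarrow> real \<Rightarrow> real" where
  "flat p y = (if y > 0 then poly p (1 / y) * exp (- (1 / y)) else 0)"

lemma flat_0 [simp]: "flat p 0 = 0"
  by (simp add: flat_def)

lemma poly_times_exp_tendsto_0: "((\<lambda>t::real. poly p t * exp (- t)) \<longlongrightarrow> 0) at_top"
proof -
  have "((\<lambda>t::real. \<Sum>i\<le>degree p. coeff p i * (t ^ i / exp t)) \<longlongrightarrow> (\<Sum>i\<le>degree p. coeff p i * 0)) at_top"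
    by (intro tendsto_intros tendsto_power_div_exp_0)
  then show ?thesis
    by (simp add: poly_altdef sum_distrib_right exp_minus divide_inverse mult.assoc)
qed

lemma flat_tendsto_0: "(flat p \<longlongrightarrow> 0) (at 0)"
proof (rule filterlim_split_at)
  have "(flat p \<longlongrightarrow> 0) (at_left 0) \<longleftrightarrow> ((\<lambda>_. 0::real) \<longlongrightarrow> 0) (at_left (0::real))"
    by (intro tendsto_cong) (auto simp: flat_def eventually_at_left_field intro: exI[of _ "-1"])
  then show "(flat p \<longlongrightarrow> 0) (at_left 0)" by simp
next
  have "((\<lambda>y::real. poly p (inverse y) * exp (- inverse y)) \<longlongrightarrow> 0) (at_right 0)"
    by (rule filterlim_compose[OF poly_times_exp_tendsto_0 filterlim_inverse_at_top_right])
  moreover have "(flat p \<longlongrightarrow> 0) (at_right 0) \<longleftrightarrow>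
      ((\<lambda>y::real. poly p (inverse y) * exp (- inverse y)) \<longlongrightarrow> 0) (at_right 0)"
    by (intro tendsto_cong eventually_mono[OF eventually_at_right_less])
      (auto simp: flat_def divide_inverse)
  ultimately show "(flat p \<longlongrightarrow> 0) (at_right 0)" by simp
qed

text \<open>With u = 1/y the derivative of p(u) exp(-u) is u^2 (p(u) - p'(u)) exp(-u), again of the
  same form. Letting the polynomial vary closes the family under differentiation, so that higher
  derivatives at 0 need no separate estimate.\<close>

lemma flat_has_derivative:
  "(flat p has_field_derivative flat ([:0, 0, 1:] * (p - pderiv p)) y) (at y)"
proof (cases y "0 :: real" rule: linorder_cases)
  case less
  have "eventually (\<lambda>z. z < 0) (nhds y)"
    using less by (intro eventually_nhds_in_open[of "{..<0}", simplified]) auto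
  then have "eventually (\<lambda>z. flat p z = 0) (nhds y)"
    by (rule eventually_mono) (auto simp: flat_def)
  then have "(flat p has_field_derivative 0) (at y) \<longleftrightarrow> ((\<lambda>_. 0::real) has_field_derivative 0) (at y)"
    by (intro DERIV_cong_ev) auto
  then show ?thesis using less by (simp add: flat_def)
next
  case equal
  \<comment> \<open>At 0 the difference quotient is itself a flat function: \<open>pCons 0 p\<close>
    multiplies the polynomial by its variable, which stands for 1/h.\<close>
  have *: "flat p h / h = flat (pCons 0 p) h" for h
    by (auto simp: flat_def)
  show ?thesis
    using flat_tendsto_0[of "pCons 0 p"] equal
    by (simp add: DERIV_def *)
next
  case greater
  have "eventually (\<lambda>z. z > 0) (nhds y)"
    using greater by (intro eventually_nhds_in_open[of "{0<..}", simplified]) auto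
  then have ev: "eventually (\<lambda>z. flat p z = poly p (1 / z) * exp (- (1 / z))) (nhds y)"
    by (rule eventually_mono) (auto simp: flat_def)
  have inv: "((\<lambda>z. 1 / z) has_field_derivative - (1 / y * (1 / y))) (at y)"
    using DERIV_inverse'[of "\<lambda>z. z" 1 y UNIV] greater by (simp add: divide_inverse)
  have "((\<lambda>z. poly p (1 / z) * exp (- (1 / z))) has_field_derivative
      poly p (1 / y) * (exp (- (1 / y)) * (1 / y * (1 / y))) +
      poly (pderiv p) (1 / y) * - (1 / y * (1 / y)) * exp (- (1 / y))) (at y)"
    using DERIV_mult[OF DERIV_chain2[OF poly_DERIV inv, of p]
      DERIV_chain2[OF DERIV_exp DERIV_minus[OF inv]]]
    by (simp add: ac_simps)
  then have "((\<lambda>z. poly p (1 / z) * exp (- (1 / z))) has_field_derivative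
      flat ([:0, 0, 1:] * (p - pderiv p)) y) (at y)"
    using greater by (simp add: flat_def algebra_simps)
  then show ?thesis
    by (subst DERIV_cong_ev[OF refl ev refl])
qed

text \<open>The product rule turns one generator into two, hence the closure under sums. The free
  factor \<open>r\<close> absorbs the inner derivative -2x/R^2 and, later, the approximating
  polynomials.\<close>

inductive flat_bump :: "real \<Rightarrow> (real \<Rightarrow> real) \<Rightarrow> bool" for R where
  base: "flat_bump R (\<lambda>x. poly r x * flat p (1 - (x / R)\<^sup>2))"
| add: "flat_bump R f \<Longrightarrow> flat_bump R g \<Longrightarrow> flat_bump R (\<lambda>x. f x + g x)"

lemma flat_bump_has_derivative:
  assumes "flat_bump R f"
  shows "\<exists>f'. flat_bump R f' \<and> (\<forall>x. (f has_field_derivative f' x) (at x))"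
  using assms
proof induction
  case (base r p)
  let ?q = "[:0, 0, 1:] * (p - pderiv p)"
  let ?g = "\<lambda>x. poly (pderiv r) x * flat p (1 - (x / R)\<^sup>2) +
    poly (r * [:0, - 2 / R\<^sup>2:]) x * flat ?q (1 - (x / R)\<^sup>2)"
  have "flat_bump R ?g" by (intro flat_bump.intros)
  moreover have "((\<lambda>x. poly r x * flat p (1 - (x / R)\<^sup>2)) has_field_derivative ?g x) (at x)" for x
  proof -
    have "((\<lambda>x. 1 - (x / R)\<^sup>2) has_field_derivative - 2 / R\<^sup>2 * x) (at x)"
      unfolding power_divide
      using DERIV_diff[OF DERIV_const DERIV_cdivide[OF DERIV_pow[of 2 x UNIV]], of 1 "R\<^sup>2"] by simp
    from DERIV_mult[OF poly_DERIV[of r x] DERIV_chain2[OF flat_has_derivative[of p] this]]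
    show ?thesis by (simp add: algebra_simps)
  qed
  ultimately show ?case by blast
next
  case (add f g)
  then obtain f' g' where "flat_bump R f'" "flat_bump R g'"
    "\<And>x. (f has_field_derivative f' x) (at x)" "\<And>x. (g has_field_derivative g' x) (at x)"
    by blast
  then show ?case
    by (intro exI[of _ "\<lambda>x. f' x + g' x"]) (auto intro: flat_bump.add derivative_intros)
qed

lemma flat_bump_deriv_iterate: "flat_bump R f \<Longrightarrow> flat_bump R ((deriv ^^ k) f)"
proof (induction k)
  case (Suc k)
  then obtain f' where f': "flat_bump R f'"
    and d: "\<And>x. ((deriv ^^ k) f has_field_derivative f' x) (at x)"
    using flat_bump_has_derivative by blast
  have "deriv ((deriv ^^ k) f) = f'" using DERIV_imp_deriv[OF d] by blast
  then show ?case using f' by simp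
qed simp

lemma flat_bump_eq_0: "flat_bump R f \<Longrightarrow> 0 < R \<Longrightarrow> R \<le> \<bar>x\<bar> \<Longrightarrow> f x = 0"
proof (induction rule: flat_bump.induct)
  case (base r p)
  then have "1\<^sup>2 \<le> \<bar>x / R\<bar>\<^sup>2" by (intro power_mono) auto
  then have "1 \<le> (x / R)\<^sup>2" unfolding power2_abs by simp
  then show ?case by (simp add: flat_def)
qed simp

lemma flat_bump_continuous: "flat_bump R f \<Longrightarrow> continuous_on UNIV f"
  by (meson DERIV_isCont continuous_at_imp_continuous_on flat_bump_has_derivative)

lemma flat_bump_test_function:
  assumes "flat_bump R f" "0 < R"
  shows "f \<in> test_functions"
proof -
  have "((deriv ^^ k) f) field_differentiable (at x)" for k x
    using flat_bump_has_derivative[OF flat_bump_deriv_iterate[OF assms(1), of k]]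
    unfolding field_differentiable_def by blast
  moreover have "continuous_on UNIV ((deriv ^^ k) f)" for k
    using flat_bump_continuous flat_bump_deriv_iterate assms(1) by blast
  moreover have "{x. f x \<noteq> 0} \<subseteq> cball 0 R"
    using flat_bump_eq_0[OF assms] by (force simp: not_le)
  then have "compact (closure {x. f x \<noteq> 0})"
    using bounded_subset[OF bounded_cball] by (simp add: compact_closure)
  ultimately show ?thesis by (simp add: test_functions_def C_class_def)
qed

lemma exists_polynomial_antiderivative: "\<exists>P. pderiv P = (q :: real poly)"
proof
  have "pderiv (\<Sum>i\<le>degree q. monom (coeff q i / (real i + 1)) (Suc i)) =
      (\<Sum>i\<le>degree q. monom (coeff q i) i)"
    using higher_pderiv_sum[of 1 "\<lambda>i. monom (coeff q i / (real i + 1)) (Suc i)"]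
    by (simp add: pderiv_monom add.commute)
  then show "pderiv (\<Sum>i\<le>degree q. monom (coeff q i / (real i + 1)) (Suc i)) = q"
    by (simp add: poly_as_sum_of_monoms)
qed

text \<open>The derivative is approximated and the result integrated, because closeness of the
  functions alone would say nothing about their derivatives.\<close>

lemma polynomial_C1_approximation:
  fixes \<theta> \<theta>' :: "real \<Rightarrow> real"
  assumes d: "\<And>x. (\<theta> has_field_derivative \<theta>' x) (at x)" and c: "continuous_on UNIV \<theta>'"
    and "0 < R" "0 < e"
  shows "\<exists>P. \<forall>x. \<bar>x\<bar> \<le> R \<longrightarrow> \<bar>poly (pderiv P) x - \<theta>' x\<bar> \<le> e \<and> \<bar>poly P x - \<theta> x\<bar> \<le> e * R"
proof -
  obtain g where "real_polynomial_function g" and g: "\<And>x. x \<in> {-R..R} \<Longrightarrow> \<bar>\<theta>' x - g x\<bar> < e"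
    using Stone_Weierstrass_real_polynomial_function[of "{-R..R}" \<theta>' e] c \<open>0 < e\<close>
    by (auto intro: continuous_on_subset)
  then obtain a N where ga: "g = (\<lambda>x. \<Sum>i\<le>(N::nat). a i * x ^ i)"
    by (auto simp: real_polynomial_function_iff_sum)
  have gq: "g x = poly (\<Sum>i\<le>N. monom (a i) i) x" for x
    by (simp add: ga poly_sum poly_monom)
  obtain P0 where P0: "pderiv P0 = (\<Sum>i\<le>N. monom (a i) i)"
    using exists_polynomial_antiderivative by blast
  \<comment> \<open>The constant makes P agree with \<theta> at 0, so the mean value inequality
    turns the error e of the derivative into e * R.\<close>
  define P where "P = P0 + [:\<theta> 0 - poly P0 0:]"
  have P: "poly (pderiv P) x = g x" for x by (simp add: P_def pderiv_add pderiv_pCons P0 gq)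
  have b: "\<bar>poly (pderiv P) x - \<theta>' x\<bar> \<le> e" if "\<bar>x\<bar> \<le> R" for x
  proof -
    have "\<bar>\<theta>' x - g x\<bar> < e" using g[of x] that by (simp add: abs_le_iff)
    then show ?thesis unfolding P by linarith
  qed
  have "\<bar>poly P x - \<theta> x\<bar> \<le> e * R" if "\<bar>x\<bar> \<le> R" for x
  proof -
    have "norm ((poly P x - \<theta> x) - (poly P 0 - \<theta> 0)) \<le> e * norm (x - 0)"
    proof (rule field_differentiable_bound)
      show "convex {-R..R}" by simp
      show "((\<lambda>x. poly P x - \<theta> x) has_field_derivative poly (pderiv P) z - \<theta>' z) (at z within {-R..R})"
        for z by (intro has_field_derivative_at_within[of _ _ _ "{-R..R}"] DERIV_diff poly_DERIV d)
      show "norm (poly (pderiv P) z - \<theta>' z) \<le> e" if "z \<in> {-R..R}" for z using b[of z] that by auto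
    qed (use that \<open>0 < R\<close> in auto)
    moreover have "poly P 0 - \<theta> 0 = 0" by (simp add: P_def)
    moreover have "e * \<bar>x\<bar> \<le> e * R" using that \<open>0 < e\<close> by (intro mult_left_mono) auto
    ultimately show ?thesis by simp
  qed
  with b show ?thesis by (intro exI[of _ P]) auto
qed

section \<open>Integration by parts for weak derivatives\<close>

lemma flat_bump_mult_poly: "flat_bump R f \<Longrightarrow> flat_bump R (\<lambda>x. poly q x * f x)"
proof (induction rule: flat_bump.induct)
  case (base r p)
  then show ?case using flat_bump.base[of R "q * r" p] by (simp add: mult.assoc)
next
  case (add f g)
  then show ?case using flat_bump.add[OF add.IH] by (simp add: distrib_left)
qed

lemma bounded_of_compact_support:
  fixes f :: "real \<Rightarrow> real"
  assumes "continuous_on UNIV f" "\<And>x. R \<le> \<bar>x\<bar> \<Longrightarrow> f x = 0"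
  shows "\<exists>B\<ge>0. \<forall>x. \<bar>f x\<bar> \<le> B"
proof -
  have "bounded (f ` {-R..R})"
    by (intro compact_imp_bounded compact_continuous_image continuous_on_subset[OF assms(1)]) auto
  then obtain B where "\<forall>x\<in>{-R..R}. \<bar>f x\<bar> \<le> B" unfolding bounded_iff by auto
  then have B: "\<And>x. x \<in> {-R..R} \<Longrightarrow> \<bar>f x\<bar> \<le> B" by blast
  have "\<bar>f x\<bar> \<le> max 0 B" for x
  proof (cases "R \<le> \<bar>x\<bar>")
    case False
    then have "x \<in> {-R..R}" by auto
    from B[OF this] show ?thesis by simp
  qed (simp add: assms(2))
  then show ?thesis by (intro exI[of _ "max 0 B"]) auto
qed

lemma continuous_lebesgue_measurable:
  "continuous_on UNIV (f :: real \<Rightarrow> real) \<Longrightarrow> f \<in> borel_measurable lebesgue"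
  by (intro measurable_completion) (simp add: borel_measurable_continuous_onI)

lemma locally_integrable_imp_integrable_indicator:
  "locally_integrable h \<Longrightarrow> integrable lebesgue (\<lambda>x. indicator {-R..R} x * h x)"
  by (simp add: locally_integrable_def set_integrable_def)

text \<open>Only truncations to compact sets are known to be integrable, so measurability comes from
  their pointwise limit.\<close>

lemma locally_integrable_imp_measurable:
  assumes "locally_integrable h"
  shows "h \<in> borel_measurable lebesgue"
proof (rule borel_measurable_LIMSEQ_real)
  show "(\<lambda>i. indicator {-real i..real i} x * h x) \<longlonglongrightarrow> h x" for x
  proof (rule tendsto_eventually)
    obtain N where "\<bar>x\<bar> \<le> real N" using real_arch_simple by blast
    then show "\<forall>\<^sub>F i in sequentially. indicator {-real i..real i} x * h x = h x"
      by (intro eventually_sequentiallyI[of N]) (auto simp: indicator_def)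
  qed
  show "(\<lambda>x. indicator {-real i..real i} x * h x) \<in> borel_measurable lebesgue" for i
    using locally_integrable_imp_integrable_indicator[OF assms] by blast
qed

lemma locally_integrable_mult_compact_support:
  assumes h: "locally_integrable h" and c: "continuous_on UNIV \<phi>"
    and z: "\<And>x. R \<le> \<bar>x\<bar> \<Longrightarrow> \<phi> x = 0"
  shows "integrable lebesgue (\<lambda>x. h x * \<phi> x)"
proof -
  obtain B where B: "\<And>x. \<bar>\<phi> x\<bar> \<le> B" using bounded_of_compact_support[OF c z] by blast
  show ?thesis
  proof (rule Bochner_Integration.integrable_bound)
    show "integrable lebesgue (\<lambda>x. B * (indicator {-R..R} x * h x))"
      by (intro integrable_mult_right locally_integrable_imp_integrable_indicator h)
    show "(\<lambda>x. h x * \<phi> x) \<in> borel_measurable lebesgue"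
      by (intro borel_measurable_times locally_integrable_imp_measurable h continuous_lebesgue_measurable c)
    have "\<bar>h x * \<phi> x\<bar> \<le> \<bar>B * (indicator {-R..R} x * h x)\<bar>" for x
    proof (cases "x \<in> {-R..R}")
      case True
      have "\<bar>\<phi> x\<bar> * \<bar>h x\<bar> \<le> \<bar>B\<bar> * \<bar>h x\<bar>" using B[of x] by (intro mult_right_mono) auto
      then show ?thesis using True by (simp add: abs_mult mult.commute)
    next
      case False
      then have "R \<le> \<bar>x\<bar>" by (auto simp: abs_le_iff)
      then show ?thesis using z[of x] by simp
    qed
    then show "AE x in lebesgue. norm (h x * \<phi> x) \<le> norm (B * (indicator {-R..R} x * h x))" by simp
  qed
qed

text \<open>For polynomial \<theta> the product with the bump is a test function and the identity is
  the definition of the weak derivative. The C^1 case is the limit along polynomials that converge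
  on [-R, R] together with their derivatives.\<close>

lemma weak_deriv_flat_bump_mult:
  assumes w: "has_weak_deriv 1 h g" and R: "0 < R"
    and b: "flat_bump R b" and b': "flat_bump R b'"
    and db: "\<And>x. (b has_field_derivative b' x) (at x)"
    and d: "\<And>x. (\<theta> has_field_derivative \<theta>' x) (at x)" and c: "continuous_on UNIV \<theta>'"
  shows "(LINT x|lebesgue. h x * (b' x * \<theta> x + b x * \<theta>' x)) = - (LINT x|lebesgue. g x * (b x * \<theta> x))"
proof -
  have h: "locally_integrable h" and g: "locally_integrable g"
    and I: "\<And>\<phi>. \<phi> \<in> test_functions \<Longrightarrow>
      (LINT x|lebesgue. h x * deriv \<phi> x) = - (LINT x|lebesgue. g x * \<phi> x)"
    using w by (auto simp: has_weak_deriv_def)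
  have c\<theta>: "continuous_on UNIV \<theta>"
    by (meson d DERIV_isCont continuous_at_imp_continuous_on)
  note cb = flat_bump_continuous[OF b] flat_bump_continuous[OF b']
  note zb = flat_bump_eq_0[OF b R] flat_bump_eq_0[OF b' R]
  have "\<forall>k. \<exists>P. \<forall>x. \<bar>x\<bar> \<le> R \<longrightarrow>
      \<bar>poly (pderiv P) x - \<theta>' x\<bar> \<le> 1 / real (Suc k) \<and> \<bar>poly P x - \<theta> x\<bar> \<le> 1 / real (Suc k) * R"
    by (intro allI polynomial_C1_approximation[OF d c R]) simp
  from choice[OF this] obtain P where "\<forall>k x. \<bar>x\<bar> \<le> R \<longrightarrow>
      \<bar>poly (pderiv (P k)) x - \<theta>' x\<bar> \<le> 1 / real (Suc k) \<and> \<bar>poly (P k) x - \<theta> x\<bar> \<le> 1 / real (Suc k) * R" by blast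
  then have P: "\<And>k x. \<bar>x\<bar> \<le> R \<Longrightarrow> \<bar>poly (pderiv (P k)) x - \<theta>' x\<bar> \<le> 1 / real (Suc k)"
     "\<And>k x. \<bar>x\<bar> \<le> R \<Longrightarrow> \<bar>poly (P k) x - \<theta> x\<bar> \<le> 1 / real (Suc k) * R" by blast+
  have lim0: "(\<lambda>k. 1 / real (Suc k)) \<longlonglongrightarrow> 0" by (rule LIMSEQ_Suc[OF lim_1_over_n])
  have lim': "(\<lambda>k. poly (pderiv (P k)) x) \<longlonglongrightarrow> \<theta>' x" if "\<bar>x\<bar> \<le> R" for x
    by (rule LIM_zero_cancel[OF Lim_null_comparison[OF _ lim0]]) (use P(1)[OF that] in simp)
  have lim: "(\<lambda>k. poly (P k) x) \<longlonglongrightarrow> \<theta> x" if "\<bar>x\<bar> \<le> R" for x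
    by (rule LIM_zero_cancel[OF Lim_null_comparison[OF _ tendsto_mult_left_zero[OF lim0, of R]]])
      (use P(2)[OF that] in simp)
  have le1: "1 / real (Suc k) \<le> 1" for k by simp
  \<comment> \<open>Domination must hold on the whole line, but the polynomials are controlled only
    on [-R, R]; beyond it the bump factors vanish.\<close>
  have bnd': "\<bar>b x * poly (pderiv (P k)) x\<bar> \<le> \<bar>b x\<bar> * (1 + \<bar>\<theta>' x\<bar>)" for k x
  proof (cases "\<bar>x\<bar> \<le> R")
    case True
    then have "\<bar>poly (pderiv (P k)) x\<bar> \<le> 1 + \<bar>\<theta>' x\<bar>" using P(1)[of x k] le1[of k] by linarith
    then show ?thesis by (simp add: abs_mult mult_left_mono)
  qed (use zb in auto)
  have bnd: "\<bar>v x * poly (P k) x\<bar> \<le> \<bar>v x\<bar> * (R + \<bar>\<theta> x\<bar>)"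
    if "\<And>x. R \<le> \<bar>x\<bar> \<Longrightarrow> v x = 0" for v k x
  proof (cases "\<bar>x\<bar> \<le> R")
    case True
    have "1 / real (Suc k) * R \<le> 1 * R" using R by (intro mult_right_mono le1) auto
    then have "\<bar>poly (P k) x\<bar> \<le> R + \<bar>\<theta> x\<bar>" using P(2)[OF True, of k] by linarith
    then show ?thesis by (simp add: abs_mult mult_left_mono)
  qed (use that in auto)
  have test: "(\<lambda>x. poly (P k) x * b x) \<in> test_functions" for k
    by (rule flat_bump_test_function[OF flat_bump_mult_poly[OF b] R])
  have der: "deriv (\<lambda>x. poly (P k) x * b x) = (\<lambda>x. b' x * poly (P k) x + b x * poly (pderiv (P k)) x)" for k
    using DERIV_imp_deriv[OF DERIV_mult[OF poly_DERIV db]] by (auto simp: fun_eq_iff algebra_simps)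
  have eq: "(LINT x|lebesgue. h x * (b' x * poly (P k) x + b x * poly (pderiv (P k)) x)) =
      - (LINT x|lebesgue. g x * (b x * poly (P k) x))" for k
    using I[OF test[of k]] unfolding der by (simp add: mult.commute)
  have A: "(\<lambda>k. LINT x|lebesgue. g x * (b x * poly (P k) x)) \<longlonglongrightarrow> (LINT x|lebesgue. g x * (b x * \<theta> x))"
  proof (rule integral_dominated_convergence)
    show "integrable lebesgue (\<lambda>x. \<bar>g x * (\<bar>b x\<bar> * (R + \<bar>\<theta> x\<bar>))\<bar>)"
      by (intro integrable_abs locally_integrable_mult_compact_support[OF g, of _ R] continuous_intros cb c\<theta>)
        (use zb in auto)
    show "(\<lambda>x. g x * (b x * \<theta> x)) \<in> borel_measurable lebesgue"
      by (intro borel_measurable_times locally_integrable_imp_measurable g continuous_lebesgue_measurable cb c\<theta>)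
    show "(\<lambda>x. g x * (b x * poly (P k) x)) \<in> borel_measurable lebesgue" for k
      by (intro borel_measurable_times locally_integrable_imp_measurable g continuous_lebesgue_measurable cb
          continuous_intros)
    have "(\<lambda>k. g x * (b x * poly (P k) x)) \<longlonglongrightarrow> g x * (b x * \<theta> x)" for x
      using lim[of x] zb(1)[of x] by (cases "\<bar>x\<bar> \<le> R") (auto intro!: tendsto_intros)
    then show "AE x in lebesgue. (\<lambda>k. g x * (b x * poly (P k) x)) \<longlonglongrightarrow> g x * (b x * \<theta> x)" by simp
    have "\<bar>g x * (b x * poly (P k) x)\<bar> \<le> \<bar>g x * (\<bar>b x\<bar> * (R + \<bar>\<theta> x\<bar>))\<bar>" for k x
      using mult_left_mono[OF bnd[where v = b and x = x and k = k, OF zb(1)], of "\<bar>g x\<bar>"] R by (simp add: abs_mult)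
    then show "AE x in lebesgue. norm (g x * (b x * poly (P k) x)) \<le> \<bar>g x * (\<bar>b x\<bar> * (R + \<bar>\<theta> x\<bar>))\<bar>" for k
      by simp
  qed
  have B: "(\<lambda>k. LINT x|lebesgue. h x * (b' x * poly (P k) x + b x * poly (pderiv (P k)) x)) \<longlonglongrightarrow>
     (LINT x|lebesgue. h x * (b' x * \<theta> x + b x * \<theta>' x))"
  proof (rule integral_dominated_convergence)
    let ?w = "\<lambda>x. \<bar>b' x\<bar> * (R + \<bar>\<theta> x\<bar>) + \<bar>b x\<bar> * (1 + \<bar>\<theta>' x\<bar>)"
    show "integrable lebesgue (\<lambda>x. \<bar>h x * ?w x\<bar>)"
      by (intro integrable_abs locally_integrable_mult_compact_support[OF h, of _ R] continuous_intros cb c\<theta> c)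
        (use zb in auto)
    show "(\<lambda>x. h x * (b' x * \<theta> x + b x * \<theta>' x)) \<in> borel_measurable lebesgue"
      by (intro borel_measurable_times borel_measurable_add locally_integrable_imp_measurable h
          continuous_lebesgue_measurable cb c\<theta> c)
    show "(\<lambda>x. h x * (b' x * poly (P k) x + b x * poly (pderiv (P k)) x)) \<in> borel_measurable lebesgue" for k
      by (intro borel_measurable_times borel_measurable_add locally_integrable_imp_measurable h
          continuous_lebesgue_measurable cb continuous_intros)
    have "(\<lambda>k. h x * (b' x * poly (P k) x + b x * poly (pderiv (P k)) x)) \<longlonglongrightarrow>
        h x * (b' x * \<theta> x + b x * \<theta>' x)" for x
      using lim[of x] lim'[of x] zb[of x] by (cases "\<bar>x\<bar> \<le> R") (auto intro!: tendsto_intros)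
    then show "AE x in lebesgue. (\<lambda>k. h x * (b' x * poly (P k) x + b x * poly (pderiv (P k)) x)) \<longlonglongrightarrow>
        h x * (b' x * \<theta> x + b x * \<theta>' x)" by simp
    have "\<bar>h x * (b' x * poly (P k) x + b x * poly (pderiv (P k)) x)\<bar> \<le> \<bar>h x * ?w x\<bar>" for k x
    proof -
      have "\<bar>b' x * poly (P k) x + b x * poly (pderiv (P k)) x\<bar> \<le> ?w x"
        using bnd[where v = b' and x = x and k = k, OF zb(2)] bnd'[of x k] by linarith
      then show ?thesis unfolding abs_mult by (intro mult_left_mono) auto
    qed
    then show "AE x in lebesgue. norm (h x * (b' x * poly (P k) x + b x * poly (pderiv (P k)) x))
        \<le> \<bar>h x * ?w x\<bar>" for k
      by simp
  qed
  show ?thesis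
    using LIMSEQ_unique[OF B[unfolded eq] tendsto_minus[OF A]] .
qed

text \<open>The cutoff is removed by dilation: its derivative contributes
  \<open>\<beta>' (x / R) / R\<close>, which tends to 0. Integrability of
  \<open>h x * \<theta> x\<close> serves to dominate this vanishing term.\<close>

lemma weak_deriv_integration_by_parts:
  assumes w: "has_weak_deriv 1 h g"
    and d: "\<And>x. (\<theta> has_field_derivative \<theta>' x) (at x)" and c: "continuous_on UNIV \<theta>'"
    and i: "integrable lebesgue (\<lambda>x. h x * \<theta> x)" "integrable lebesgue (\<lambda>x. h x * \<theta>' x)"
      "integrable lebesgue (\<lambda>x. g x * \<theta> x)"
  shows "(LINT x|lebesgue. h x * \<theta>' x) = - (LINT x|lebesgue. g x * \<theta> x)"
proof -
  have c\<theta>: "continuous_on UNIV \<theta>"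
    by (meson d DERIV_isCont continuous_at_imp_continuous_on)
  have m: "h \<in> borel_measurable lebesgue" "g \<in> borel_measurable lebesgue"
    using w by (auto simp: has_weak_deriv_def locally_integrable_imp_measurable)
  \<comment> \<open>On (-1, 1) this is exp(-1/(1 - x^2)). Its value at 0 is not 1, so the limit
    identity carries the factor \<open>\<beta> 0\<close>, which is cancelled at the end.\<close>
  define \<beta> :: "real \<Rightarrow> real" where "\<beta> = (\<lambda>x. flat 1 (1 - x\<^sup>2))"
  define \<beta>' :: "real \<Rightarrow> real" where "\<beta>' = (\<lambda>x. - 2 * x * flat [:0, 0, 1:] (1 - x\<^sup>2))"
  have bump: "flat_bump R (\<lambda>x. \<beta> (x / R))" "flat_bump R (\<lambda>x. \<beta>' (x / R) / R)" for R
    using flat_bump.base[of R 1 1] flat_bump.base[of R "[:0, - 2 / R / R:]" "[:0, 0, 1:]"]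
    by (simp_all add: \<beta>_def \<beta>'_def mult_ac)
  have d\<beta>: "(\<beta> has_field_derivative \<beta>' x) (at x)" for x
  proof -
    have "((\<lambda>x. 1 - x\<^sup>2) has_field_derivative - 2 * x) (at x)"
      by (auto intro!: derivative_eq_intros)
    from DERIV_chain2[OF flat_has_derivative[of 1] this]
    show ?thesis by (simp add: \<beta>_def \<beta>'_def mult_ac)
  qed
  have db: "((\<lambda>x. \<beta> (x / R)) has_field_derivative \<beta>' (x / R) / R) (at x)" for R x
    using DERIV_chain2[OF d\<beta> DERIV_cdivide[OF DERIV_ident]] by simp
  have b1: "flat_bump 1 \<beta>" "flat_bump 1 \<beta>'" using bump[of 1] by simp_all
  obtain B where B: "0 \<le> B" "\<And>x. \<bar>\<beta> x\<bar> \<le> B"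
    using bounded_of_compact_support[OF flat_bump_continuous flat_bump_eq_0, OF b1(1) b1(1)] by auto
  obtain B' where B': "0 \<le> B'" "\<And>x. \<bar>\<beta>' x\<bar> \<le> B'"
    using bounded_of_compact_support[OF flat_bump_continuous flat_bump_eq_0, OF b1(2) b1(2)] by auto
  \<comment> \<open>Radii of at least 1 keep \<open>\<beta>' (x / r k) / r k\<close> below
    \<open>B'\<close> for all k.\<close>
  define r where "r k = real (Suc k)" for k
  have r: "0 < r k" "1 \<le> r k" for k by (auto simp: r_def)
  have eq: "(LINT x|lebesgue. h x * (\<beta>' (x / r k) / r k * \<theta> x + \<beta> (x / r k) * \<theta>' x)) =
      - (LINT x|lebesgue. g x * (\<beta> (x / r k) * \<theta> x))" for k
    by (rule weak_deriv_flat_bump_mult[OF w r(1) bump db d c])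
  have rlim: "(\<lambda>k. x / r k) \<longlonglongrightarrow> 0" for x
    unfolding r_def using LIMSEQ_Suc[OF lim_const_over_n] .
  have lim: "(\<lambda>k. \<beta> (x / r k)) \<longlonglongrightarrow> \<beta> 0" for x
    by (rule isCont_tendsto_compose[OF DERIV_isCont[OF d\<beta>] rlim])
  have lim': "(\<lambda>k. \<beta>' (x / r k) / r k) \<longlonglongrightarrow> 0" for x
    by (rule Lim_null_comparison[OF _ rlim[of B']])
      (use B' r in \<open>auto intro!: always_eventually divide_right_mono simp: abs_of_pos less_imp_le\<close>)
  have \<beta>0: "\<beta> 0 \<noteq> 0" by (simp add: \<beta>_def flat_def)
  have cb: "continuous_on UNIV (\<lambda>x. \<beta> (x / r k))" "continuous_on UNIV (\<lambda>x. \<beta>' (x / r k) / r k)" for k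
    using flat_bump_continuous bump by blast+
  have A: "(\<lambda>k. LINT x|lebesgue. g x * (\<beta> (x / r k) * \<theta> x)) \<longlonglongrightarrow> (LINT x|lebesgue. g x * (\<beta> 0 * \<theta> x))"
  proof (rule integral_dominated_convergence)
    show "integrable lebesgue (\<lambda>x. B * \<bar>g x * \<theta> x\<bar>)"
      by (intro integrable_abs integrable_mult_right i)
    show "(\<lambda>x. g x * (\<beta> 0 * \<theta> x)) \<in> borel_measurable lebesgue"
      by (intro borel_measurable_times m borel_measurable_const continuous_lebesgue_measurable c\<theta>)
    show "(\<lambda>x. g x * (\<beta> (x / r k) * \<theta> x)) \<in> borel_measurable lebesgue" for k
      by (intro borel_measurable_times m continuous_lebesgue_measurable c\<theta> cb)
    show "AE x in lebesgue. (\<lambda>k. g x * (\<beta> (x / r k) * \<theta> x)) \<longlonglongrightarrow> g x * (\<beta> 0 * \<theta> x)"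
      by (intro AE_I2 tendsto_intros lim)
    have "\<bar>\<beta> (x / r k)\<bar> * \<bar>g x * \<theta> x\<bar> \<le> B * \<bar>g x * \<theta> x\<bar>" for k x
      by (intro mult_right_mono B(2)) auto
    then show "AE x in lebesgue. norm (g x * (\<beta> (x / r k) * \<theta> x)) \<le> B * \<bar>g x * \<theta> x\<bar>" for k
      by (simp add: abs_mult mult_ac)
  qed
  have C: "(\<lambda>k. LINT x|lebesgue. h x * (\<beta>' (x / r k) / r k * \<theta> x + \<beta> (x / r k) * \<theta>' x)) \<longlonglongrightarrow>
     (LINT x|lebesgue. h x * (0 * \<theta> x + \<beta> 0 * \<theta>' x))"
  proof (rule integral_dominated_convergence)
    show "integrable lebesgue (\<lambda>x. B' * \<bar>h x * \<theta> x\<bar> + B * \<bar>h x * \<theta>' x\<bar>)"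
      by (intro integrable_abs integrable_mult_right Bochner_Integration.integrable_add i)
    show "(\<lambda>x. h x * (0 * \<theta> x + \<beta> 0 * \<theta>' x)) \<in> borel_measurable lebesgue"
      by (intro borel_measurable_times borel_measurable_add m borel_measurable_const
          continuous_lebesgue_measurable c\<theta> c)
    show "(\<lambda>x. h x * (\<beta>' (x / r k) / r k * \<theta> x + \<beta> (x / r k) * \<theta>' x)) \<in> borel_measurable lebesgue" for k
      by (intro borel_measurable_times[OF m(1)] borel_measurable_add borel_measurable_times
          continuous_lebesgue_measurable[OF c\<theta>] continuous_lebesgue_measurable[OF c]
          continuous_lebesgue_measurable[OF cb(1)] continuous_lebesgue_measurable[OF cb(2)])
    show "AE x in lebesgue. (\<lambda>k. h x * (\<beta>' (x / r k) / r k * \<theta> x + \<beta> (x / r k) * \<theta>' x)) \<longlonglongrightarrow>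
        h x * (0 * \<theta> x + \<beta> 0 * \<theta>' x)"
      by (intro AE_I2 tendsto_mult tendsto_add tendsto_const lim lim')
    have "\<bar>h x * (\<beta>' (x / r k) / r k * \<theta> x + \<beta> (x / r k) * \<theta>' x)\<bar> \<le>
        B' * \<bar>h x * \<theta> x\<bar> + B * \<bar>h x * \<theta>' x\<bar>" for k x
    proof -
      have "\<bar>\<beta>' (x / r k) / r k\<bar> \<le> \<bar>\<beta>' (x / r k)\<bar> / 1"
        unfolding abs_divide by (intro divide_left_mono) (use r[of k] in auto)
      then have b: "\<bar>\<beta>' (x / r k) / r k\<bar> \<le> B'" using B'(2)[of "x / r k"] by simp
      have "\<bar>h x * (\<beta>' (x / r k) / r k * \<theta> x + \<beta> (x / r k) * \<theta>' x)\<bar> \<le>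
          \<bar>h x * (\<beta>' (x / r k) / r k * \<theta> x)\<bar> + \<bar>h x * (\<beta> (x / r k) * \<theta>' x)\<bar>"
        unfolding distrib_left by (rule abs_triangle_ineq)
      also have "\<dots> = \<bar>\<beta>' (x / r k) / r k\<bar> * \<bar>h x * \<theta> x\<bar> + \<bar>\<beta> (x / r k)\<bar> * \<bar>h x * \<theta>' x\<bar>"
        by (simp add: abs_mult mult_ac)
      also have "\<dots> \<le> B' * \<bar>h x * \<theta> x\<bar> + B * \<bar>h x * \<theta>' x\<bar>"
        by (intro add_mono mult_right_mono b B(2)) auto
      finally show ?thesis .
    qed
    then show "AE x in lebesgue. norm (h x * (\<beta>' (x / r k) / r k * \<theta> x + \<beta> (x / r k) * \<theta>' x)) \<le>
        B' * \<bar>h x * \<theta> x\<bar> + B * \<bar>h x * \<theta>' x\<bar>" for k by simp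
  qed
  have "(LINT x|lebesgue. \<beta> 0 * (h x * \<theta>' x)) = - (LINT x|lebesgue. \<beta> 0 * (g x * \<theta> x))"
    using LIMSEQ_unique[OF C[unfolded eq] tendsto_minus[OF A]] by (simp add: mult_ac)
  then have "\<beta> 0 * (LINT x|lebesgue. h x * \<theta>' x) = \<beta> 0 * - (LINT x|lebesgue. g x * \<theta> x)" by simp
  then show ?thesis using \<beta>0 unfolding mult_cancel_left by blast
qed

section \<open>Weak derivatives of consecutive orders\<close>

lemma test_function_deriv:
  assumes "\<phi> \<in> test_functions"
  shows "deriv \<phi> \<in> test_functions"
proof -
  have it: "(deriv ^^ k) (deriv \<phi>) = (deriv ^^ Suc k) \<phi>" for k
    by (simp only: funpow_Suc_right comp_def)
  have C: "\<phi> \<in> C_class k" for k using assms by (simp add: test_functions_def)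
  have "deriv \<phi> \<in> C_class k" for k
    using C[of "Suc k"] unfolding C_class_def mem_Collect_eq it by blast
  \<comment> \<open>Off the closed support \<phi> vanishes in a whole neighbourhood, hence so does
    its derivative.\<close>
  moreover have "{x. deriv \<phi> x \<noteq> 0} \<subseteq> closure {x. \<phi> x \<noteq> 0}"
  proof (rule subsetI, rule ccontr)
    fix x assume x: "x \<in> {x. deriv \<phi> x \<noteq> 0}" "x \<notin> closure {x. \<phi> x \<noteq> 0}"
    have "eventually (\<lambda>y. y \<in> - closure {x. \<phi> x \<noteq> 0}) (nhds x)"
      using x(2) by (intro eventually_nhds_in_open) auto
    then have "eventually (\<lambda>y. \<phi> y = 0) (nhds x)"
      by (rule eventually_mono) (use closure_subset[of "{x. \<phi> x \<noteq> 0}"] in auto)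
    then have "deriv \<phi> x = deriv (\<lambda>_. 0) x" by (intro deriv_cong_ev) auto
    then show False using x(1) by simp
  qed
  then have "closure {x. deriv \<phi> x \<noteq> 0} \<subseteq> closure {x. \<phi> x \<noteq> 0}"
    by (simp add: closure_minimal)
  then have "compact (closure {x. deriv \<phi> x \<noteq> 0})"
    using assms compact_Int_closed[of "closure {x. \<phi> x \<noteq> 0}" "closure {x. deriv \<phi> x \<noteq> 0}"]
    by (simp add: test_functions_def Int_absorb1)
  ultimately show ?thesis by (simp add: test_functions_def)
qed

text \<open>Testing the k-th weak derivative with \<open>deriv \<phi>\<close> puts k + 1 derivatives
  on \<phi>; the sign (-1)^k appears on both sides and cancels. Every integration by parts is
  thereby reduced to order one.\<close>

lemma has_weak_deriv_successive:
  assumes "has_weak_deriv k f g" "has_weak_deriv (Suc k) f g'"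
  shows "has_weak_deriv 1 g g'"
proof -
  have "(LINT x|lebesgue. g x * deriv \<phi> x) = - (LINT x|lebesgue. g' x * \<phi> x)"
    if \<phi>: "\<phi> \<in> test_functions" for \<phi>
  proof -
    have "(- 1) ^ k * (LINT x|lebesgue. g x * deriv \<phi> x) = (LINT x|lebesgue. f x * (deriv ^^ k) (deriv \<phi>) x)"
      using assms(1) test_function_deriv[OF \<phi>] by (simp add: has_weak_deriv_def)
    also have "\<dots> = (LINT x|lebesgue. f x * (deriv ^^ Suc k) \<phi> x)"
      by (simp only: funpow_Suc_right comp_def)
    also have "\<dots> = (- 1) ^ k * - (LINT x|lebesgue. g' x * \<phi> x)"
      using assms(2) \<phi> by (simp add: has_weak_deriv_def del: funpow.simps)
    finally show ?thesis unfolding mult_cancel_left by simp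
  qed
  then show ?thesis using assms by (simp add: has_weak_deriv_def)
qed

section \<open>Decaying antiderivatives\<close>

text \<open>The rate is divided among the factors: 1 + t \<le> (1 + 1/\<epsilon>) exp(\<epsilon> t),
  whose k-th power has rate k \<epsilon> \<le> \<delta>.\<close>

lemma power_le_exp:
  fixes \<delta> :: real
  assumes "0 < \<delta>"
  shows "\<exists>M>0. \<forall>t\<ge>0. (1 + t) ^ k \<le> M * exp (\<delta> * t)"
proof -
  \<comment> \<open>Dividing by k + 1 instead of k keeps \<epsilon> positive for k = 0.\<close>
  define \<epsilon> where "\<epsilon> = \<delta> / real (Suc k)"
  have \<epsilon>: "0 < \<epsilon>" "real k * \<epsilon> \<le> \<delta>" using assms by (auto simp: \<epsilon>_def field_simps)
  have "(1 + t) ^ k \<le> (1 + 1 / \<epsilon>) ^ k * exp (\<delta> * t)" if "0 \<le> t" for t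
  proof -
    have "1 + t \<le> (1 + 1 / \<epsilon>) * (1 + \<epsilon> * t)" using \<epsilon>(1) that by (simp add: field_simps)
    also have "\<dots> \<le> (1 + 1 / \<epsilon>) * exp (\<epsilon> * t)"
      using \<epsilon>(1) by (intro mult_left_mono exp_ge_add_one_self) auto
    finally have "(1 + t) ^ k \<le> ((1 + 1 / \<epsilon>) * exp (\<epsilon> * t)) ^ k"
      using that by (intro power_mono) auto
    also have "\<dots> = (1 + 1 / \<epsilon>) ^ k * exp (real k * \<epsilon> * t)"
      by (simp add: power_mult_distrib exp_of_nat_mult[symmetric] mult.assoc)
    also have "\<dots> \<le> (1 + 1 / \<epsilon>) ^ k * exp (\<delta> * t)"
      using \<epsilon> that by (intro mult_left_mono) (auto intro!: mult_right_mono zero_le_power add_nonneg_nonneg)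
    finally show ?thesis .
  qed
  moreover have "0 < (1 + 1 / \<epsilon>) ^ k" using \<epsilon>(1) by (intro zero_less_power add_pos_pos) auto
  ultimately show ?thesis by blast
qed

text \<open>Comparison with the derivative of arctan. This weight majorises the exponentials and
  later also the rapidly decreasing test functions.\<close>

lemma integrable_inverse_square_weight: "integrable lebesgue (\<lambda>x::real. inverse ((1 + \<bar>x\<bar>)\<^sup>2))"
proof -
  have "integrable lborel (\<lambda>x::real. inverse (1 + x\<^sup>2))"
    using integrable_inverse_1_plus_square by (simp add: set_integrable_def)
  then have "integrable lborel (\<lambda>x::real. inverse ((1 + \<bar>x\<bar>)\<^sup>2))"
  proof (rule Bochner_Integration.integrable_bound)
    have "inverse ((1 + \<bar>x\<bar>)\<^sup>2) \<le> inverse (1 + x\<^sup>2)" for x :: real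
      by (rule le_imp_inverse_le) (auto simp: power2_eq_square algebra_simps add_pos_nonneg)
    then show "AE x in lborel. norm (inverse ((1 + \<bar>x\<bar>)\<^sup>2)) \<le> norm (inverse (1 + x\<^sup>2 :: real))"
      by (simp add: abs_of_nonneg)
  qed simp
  then show ?thesis by (simp add: integrable_completion)
qed

lemma integrable_exp_abs:
  assumes "0 < \<gamma>"
  shows "integrable lebesgue (\<lambda>x::real. exp (- \<gamma> * \<bar>x\<bar>))"
proof -
  obtain M where M: "\<And>t. 0 \<le> t \<Longrightarrow> (1 + t)\<^sup>2 \<le> M * exp (\<gamma> * t)"
    using power_le_exp[OF assms, of 2] by blast
  show ?thesis
  proof (rule Bochner_Integration.integrable_bound)
    show "integrable lebesgue (\<lambda>x::real. M * inverse ((1 + \<bar>x\<bar>)\<^sup>2))"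
      by (intro integrable_mult_right integrable_inverse_square_weight)
    show "(\<lambda>x::real. exp (- \<gamma> * \<bar>x\<bar>)) \<in> borel_measurable lebesgue"
      by (intro continuous_lebesgue_measurable continuous_intros)
    have "exp (- \<gamma> * \<bar>x\<bar>) \<le> \<bar>M * inverse ((1 + \<bar>x\<bar>)\<^sup>2)\<bar>" for x :: real
    proof -
      have "exp (- \<gamma> * \<bar>x\<bar>) \<le> M * inverse ((1 + \<bar>x\<bar>)\<^sup>2)"
        using M[of "\<bar>x\<bar>"] by (simp add: exp_minus field_simps add_pos_nonneg)
      then show ?thesis by linarith
    qed
    then show "AE x in lebesgue. norm (exp (- \<gamma> * \<bar>x\<bar>)) \<le> norm (M * inverse ((1 + \<bar>x\<bar>)\<^sup>2))" by simp
  qed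
qed

lemma integrable_exp_abs_affine:
  assumes "0 < \<gamma>" "a \<noteq> 0"
  shows "integrable lebesgue (\<lambda>x::real. exp (- \<gamma> * \<bar>a * x - b\<bar>))"
proof -
  have m: "(\<lambda>x::real. exp (- \<gamma> * \<bar>c * x - d\<bar>)) \<in> borel_measurable lborel" for c d by simp
  have "integrable lborel (\<lambda>x::real. exp (- \<gamma> * \<bar>x\<bar>))"
    using integrable_exp_abs[OF assms(1)] m[of 1 0] by (subst (asm) integrable_completion) auto
  from lborel_integrable_real_affine[OF this assms(2), of "- b"]
  have "integrable lborel (\<lambda>x::real. exp (- \<gamma> * \<bar>a * x - b\<bar>))" by simp
  then show ?thesis using m by (subst integrable_completion) auto
qed

text \<open>Rate and constant stay existential because the estimates for multiplication by powers
  and for integration both halve the rate. Continuity is included so that antiderivatives are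
  C^1.\<close>

definition exp_decaying :: "(real \<Rightarrow> real) \<Rightarrow> bool" where
  "exp_decaying f \<longleftrightarrow> continuous_on UNIV f \<and> (\<exists>C>0. \<exists>\<gamma>>0. \<forall>x. \<bar>f x\<bar> \<le> C * exp (- \<gamma> * \<bar>x\<bar>))"

lemma exp_decaying_integrable:
  assumes "exp_decaying f"
  shows "integrable lebesgue f"
proof -
  obtain C \<gamma> where C: "0 < \<gamma>" "0 < C" "\<And>x. \<bar>f x\<bar> \<le> C * exp (- \<gamma> * \<bar>x\<bar>)"
    using assms unfolding exp_decaying_def by blast
  show ?thesis
  proof (rule Bochner_Integration.integrable_bound)
    show "integrable lebesgue (\<lambda>x::real. C * exp (- \<gamma> * \<bar>x\<bar>))"
      by (intro integrable_mult_right integrable_exp_abs C)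
    show "f \<in> borel_measurable lebesgue"
      using assms by (auto simp: exp_decaying_def continuous_lebesgue_measurable)
    show "AE x in lebesgue. norm (f x) \<le> norm (C * exp (- \<gamma> * \<bar>x\<bar>))"
      using C by (simp add: abs_mult)
  qed
qed

lemma exp_decaying_power_mult:
  assumes "exp_decaying f"
  shows "exp_decaying (\<lambda>x. x ^ k * f x)"
proof -
  obtain C \<gamma> where C: "0 < C" "0 < \<gamma>" "\<And>x. \<bar>f x\<bar> \<le> C * exp (- \<gamma> * \<bar>x\<bar>)"
    using assms unfolding exp_decaying_def by blast
  obtain M where M: "0 < M" "\<And>t. 0 \<le> t \<Longrightarrow> (1 + t) ^ k \<le> M * exp (\<gamma> / 2 * t)"
    using power_le_exp[of "\<gamma> / 2" k] C(2) by auto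
  have "\<bar>x ^ k * f x\<bar> \<le> (M * C) * exp (- (\<gamma> / 2) * \<bar>x\<bar>)" for x
  proof -
    have "\<bar>x\<bar> ^ k \<le> (1 + \<bar>x\<bar>) ^ k" by (intro power_mono) auto
    also have "\<dots> \<le> M * exp (\<gamma> / 2 * \<bar>x\<bar>)" by (rule M(2)) simp
    finally have "\<bar>x\<bar> ^ k * \<bar>f x\<bar> \<le> (M * exp (\<gamma> / 2 * \<bar>x\<bar>)) * (C * exp (- \<gamma> * \<bar>x\<bar>))"
      by (intro mult_mono C) (use M in auto)
    also have "\<dots> = (M * C) * (exp (\<gamma> / 2 * \<bar>x\<bar>) * exp (- \<gamma> * \<bar>x\<bar>))" by simp
    also have "exp (\<gamma> / 2 * \<bar>x\<bar>) * exp (- \<gamma> * \<bar>x\<bar>) = exp (- (\<gamma> / 2) * \<bar>x\<bar>)"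
      by (simp add: exp_add[symmetric])
    finally show ?thesis by (simp add: abs_mult power_abs)
  qed
  moreover have "0 < M * C" "0 < \<gamma> / 2" using M C by auto
  moreover have "continuous_on UNIV (\<lambda>x. x ^ k * f x)"
    using assms by (auto simp: exp_decaying_def intro!: continuous_intros)
  ultimately show ?thesis unfolding exp_decaying_def by blast
qed

lemma exp_decaying_tendsto_0:
  assumes "exp_decaying f"
  shows "(f \<longlongrightarrow> 0) at_top" "(f \<longlongrightarrow> 0) at_bot"
proof -
  obtain C \<gamma> where C: "0 < C" "0 < \<gamma>" "\<And>x. \<bar>f x\<bar> \<le> C * exp (- \<gamma> * \<bar>x\<bar>)"
    using assms unfolding exp_decaying_def by blast
  have l: "filterlim (\<lambda>x::real. \<gamma> * \<bar>x\<bar>) at_top F" if "filterlim (\<lambda>x::real. \<bar>x\<bar>) at_top F" for F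
    by (rule filterlim_tendsto_pos_mult_at_top[OF tendsto_const C(2) that])
  have e: "((\<lambda>x. C * exp (- \<gamma> * \<bar>x\<bar>)) \<longlongrightarrow> 0) F" if "filterlim (\<lambda>x::real. \<bar>x\<bar>) at_top F" for F
    using tendsto_mult_right_zero[OF filterlim_compose[OF exp_at_bot
        filterlim_compose[OF filterlim_uminus_at_bot_at_top l[OF that]]], of C] by simp
  have "filterlim (\<lambda>x::real. \<bar>x\<bar>) at_top at_top"
    by (rule filterlim_abs_real)
  moreover have "filterlim (\<lambda>x::real. \<bar>x\<bar>) at_top at_bot"
    by (rule filterlim_at_top_mono[OF filterlim_uminus_at_top_at_bot]) (auto intro: always_eventually)
  ultimately have "filterlim (\<lambda>x::real. \<bar>x\<bar>) at_top at_top" "filterlim (\<lambda>x::real. \<bar>x\<bar>) at_top at_bot" .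
  from this[THEN e] show "(f \<longlongrightarrow> 0) at_top" "(f \<longlongrightarrow> 0) at_bot"
    by - (rule Lim_null_comparison[rotated], assumption, intro always_eventually, use C(3) in simp)+
qed

text \<open>The primitive started at -\<infinity> decays to the left in any case; to the right it
  equals minus the remaining tail because the total integral is zero.\<close>

lemma exp_decaying_antiderivative:
  assumes f: "exp_decaying f" and z: "(LINT x|lebesgue. f x) = 0"
  shows "\<exists>F. exp_decaying F \<and> (\<forall>x. (F has_field_derivative f x) (at x))"
proof -
  obtain C \<gamma> where C: "0 < C" "0 < \<gamma>" "\<And>x. \<bar>f x\<bar> \<le> C * exp (- \<gamma> * \<bar>x\<bar>)"
    using f unfolding exp_decaying_def by blast
  have cf: "continuous_on UNIV f" using f by (simp add: exp_decaying_def)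
  \<comment> \<open>Half of the rate is extracted as decay in the endpoint x; the other half remains
    as an integrable majorant.\<close>
  define e where "e t = exp (- (\<gamma> / 2) * \<bar>t\<bar>)" for t :: real
  have on: "h integrable_on S" if "integrable lebesgue h" "S \<in> sets lebesgue" for h :: "real \<Rightarrow> real" and S
  proof -
    have "set_integrable lebesgue UNIV h" using that by (simp add: set_integrable_def)
    then have "set_integrable lebesgue S h" by (rule set_integrable_subset) (use that in auto)
    then show ?thesis by (rule set_lebesgue_integral_eq_integral)
  qed
  have ie: "integrable lebesgue e" unfolding e_def using C by (intro integrable_exp_abs) auto
  note if' = exp_decaying_integrable[OF f]
  define F where "F x = integral {..x} f" for x
  have tot: "integral UNIV f = 0"
    using z set_lebesgue_integral_eq_integral(2)[where S = UNIV and f = f] if'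
    by (simp add: set_lebesgue_integral_def set_integrable_def)
  \<comment> \<open>A general set beyond distance |x| covers both the left tail for x \<le> 0 and
    the right tail for x > 0.\<close>
  have b: "\<bar>integral S f\<bar> \<le> C * integral UNIV e * exp (- (\<gamma> / 2) * \<bar>x\<bar>)"
    if S: "S \<in> sets lebesgue" "\<And>t. t \<in> S \<Longrightarrow> \<bar>x\<bar> \<le> \<bar>t\<bar>" for S x
  proof -
    have "norm (integral S f) \<le> integral S (\<lambda>t. C * exp (- (\<gamma> / 2) * \<bar>x\<bar>) * e t)"
    proof (rule integral_norm_bound_integral)
      show "f integrable_on S" by (rule on[OF if' S(1)])
      show "(\<lambda>t. C * exp (- (\<gamma> / 2) * \<bar>x\<bar>) * e t) integrable_on S"
        by (intro on S integrable_mult_right ie)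
      fix t assume "t \<in> S"
      then have "\<gamma> / 2 * \<bar>x\<bar> \<le> \<gamma> / 2 * \<bar>t\<bar>" using S(2) C(2) by (intro mult_left_mono) auto
      then have "exp (- \<gamma> * \<bar>t\<bar>) \<le> exp (- (\<gamma> / 2) * \<bar>x\<bar>) * e t"
        by (simp add: e_def exp_add[symmetric])
      then show "norm (f t) \<le> C * exp (- (\<gamma> / 2) * \<bar>x\<bar>) * e t"
        using C(1) C(3)[of t] by (metis real_norm_def mult.assoc mult_left_mono less_imp_le order_trans)
    qed
    also have "\<dots> = C * exp (- (\<gamma> / 2) * \<bar>x\<bar>) * integral S e" by simp
    also have "\<dots> \<le> C * exp (- (\<gamma> / 2) * \<bar>x\<bar>) * integral UNIV e"
      using C(1) by (intro mult_left_mono integral_subset_le on S ie) (auto simp: e_def)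
    finally show ?thesis by (simp add: mult_ac)
  qed
  have Fb: "\<bar>F x\<bar> \<le> (C * integral UNIV e + 1) * exp (- (\<gamma> / 2) * \<bar>x\<bar>)" for x
  proof -
    have "\<bar>F x\<bar> \<le> C * integral UNIV e * exp (- (\<gamma> / 2) * \<bar>x\<bar>)"
    proof (cases "x \<le> 0")
      case True
      then show ?thesis unfolding F_def by (intro b) auto
    next
      case False
      have "integral ({..x} \<union> {x..}) f = integral {..x} f + integral {x..} f"
        by (rule integral_Un) (auto intro!: on if' simp: Int_def intro: negligible_subset[of "{x}"])
      moreover have "{..x} \<union> {x..} = UNIV" by auto
      ultimately have "F x = - integral {x..} f" using tot by (simp add: F_def)
      then show ?thesis using b[of "{x..}" x] False by simp
    qed
    then show ?thesis by (simp add: distrib_right add_increasing2)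
  qed
  have "0 \<le> C * integral UNIV e" using C(1) by (intro mult_nonneg_nonneg integral_nonneg on ie) (auto simp: e_def)
  then have Cp: "0 < C * integral UNIV e + 1" by simp
  have d: "(F has_field_derivative f x) (at x)" for x
  proof -
    \<comment> \<open>A finite base point reduces differentiation to the fundamental theorem on an
      interval; F differs from that integral by the constant \<open>F a\<close>.\<close>
    define a where "a = x - 1"
    have "((\<lambda>z. integral {a..z} f) has_real_derivative f x) (at x within {a..x + 1})"
      by (rule integral_has_real_derivative) (auto simp: a_def intro: continuous_on_subset[OF cf])
    then have "((\<lambda>z. integral {a..z} f) has_real_derivative f x) (at x)"
      by (simp add: a_def at_within_Icc_at)
    then have 1: "((\<lambda>z. F a + integral {a..z} f) has_real_derivative f x) (at x)"
      by (auto intro!: derivative_eq_intros)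
    have "eventually (\<lambda>z. z \<in> {a<..}) (nhds x)"
      by (rule eventually_nhds_in_open) (auto simp: a_def)
    then have 2: "eventually (\<lambda>z. F a + integral {a..z} f = F z) (nhds x)"
    proof (rule eventually_mono)
      fix z assume z: "z \<in> {a<..}"
      have "integral ({..a} \<union> {a..z}) f = integral {..a} f + integral {a..z} f"
        by (rule integral_Un) (auto intro!: on if' intro: negligible_subset[of "{a}"])
      moreover have "{..a} \<union> {a..z} = {..z}" using z by auto
      ultimately show "F a + integral {a..z} f = F z" by (simp add: F_def)
    qed
    show ?thesis using 1 DERIV_cong_ev[OF refl 2 refl] by simp
  qed
  have "continuous_on UNIV F" by (meson d DERIV_isCont continuous_at_imp_continuous_on)
  moreover have "0 < \<gamma> / 2" using C by simp
  ultimately have "exp_decaying F" unfolding exp_decaying_def using Fb Cp by blast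
  with d show ?thesis by blast
qed

text \<open>The function x^(k+1) F(x) vanishes at both ends, so its derivative has integral zero.
  Hence F inherits the vanishing moments of f with the order lowered by one.\<close>

lemma exp_decaying_moment:
  assumes F: "exp_decaying F" and f: "exp_decaying f"
    and d: "\<And>x. (F has_field_derivative f x) (at x)"
  shows "real (Suc k) * (LINT x|lebesgue. x ^ k * F x) = - (LINT x|lebesgue. x ^ Suc k * f x)"
proof -
  let ?g = "\<lambda>x. real (Suc k) * (x ^ k * F x) + x ^ Suc k * f x"
  note i = exp_decaying_integrable[OF exp_decaying_power_mult]
  have cont: "continuous_on UNIV ?g"
    using F f by (auto simp: exp_decaying_def intro!: continuous_intros)
  have ig: "integrable lebesgue ?g"
    by (intro Bochner_Integration.integrable_add integrable_mult_right i F f)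
  have mg: "?g \<in> borel_measurable lborel"
    using borel_measurable_continuous_onI[OF cont] by simp
  have "(LBINT x=-\<infinity>..\<infinity>. ?g x) = 0 - 0"
  proof (rule interval_integral_FTC_integrable)
    show "((\<lambda>x. x ^ Suc k * F x) has_vector_derivative ?g x) (at x)" for x
      unfolding has_real_derivative_iff_has_vector_derivative[symmetric]
      by (auto intro!: derivative_eq_intros d simp: algebra_simps simp del: power_Suc)
    show "isCont ?g x" for x using cont by (simp add: continuous_on_eq_continuous_at)
    show "set_integrable lborel (einterval (- \<infinity>) \<infinity>) ?g"
      using ig mg by (simp add: set_integrable_def integrable_completion)
    show "(((\<lambda>x. x ^ Suc k * F x) \<circ> real_of_ereal) \<longlongrightarrow> 0) (at_right (- \<infinity>))"
      "(((\<lambda>x. x ^ Suc k * F x) \<circ> real_of_ereal) \<longlongrightarrow> 0) (at_left \<infinity>)"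
      unfolding ereal_tendsto_simps
      by (rule exp_decaying_tendsto_0[OF exp_decaying_power_mult[OF F]])+
  qed simp
  then have "(LINT x|lebesgue. ?g x) = 0"
    using mg by (simp add: interval_lebesgue_integral_def set_lebesgue_integral_def integral_completion)
  then show ?thesis
    by (subst (asm) Bochner_Integration.integral_add) (auto intro!: integrable_mult_right i F f simp del: power_Suc)
qed

section \<open>Products of L_p functions with decaying functions\<close>

lemma Lp_finite_integrable:
  assumes "f \<in> Lp p" "p \<noteq> top"
  shows "integrable lebesgue (\<lambda>x. \<bar>f x\<bar> powr enn2real p)"
proof -
  have [measurable]: "f \<in> borel_measurable lebesgue" using assms by (simp add: Lp_def)
  have "(\<integral>\<^sup>+x. ennreal (\<bar>f x\<bar> powr enn2real p) \<partial>lebesgue) < top"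
    using assms by (auto simp: Lp_def Lp_norm_def ennreal_powr_def less_top split: if_splits)
  then show ?thesis by (intro integrableI_bounded) auto
qed

lemma Lp_top_bound:
  assumes "f \<in> Lp top"
  shows "AE x in lebesgue. \<bar>f x\<bar> \<le> enn2real (Lp_norm top f)"
proof -
  have "Lp_norm top f < top" using assms by (simp add: Lp_def)
  then have "ennreal (enn2real (Lp_norm top f)) = Lp_norm top f" by simp
  moreover have "AE x in lebesgue. ennreal \<bar>f x\<bar> \<le> Lp_norm top f"
    using esssup_AE[of "\<lambda>x. ennreal \<bar>f x\<bar>" lebesgue] by (simp add: Lp_norm_def)
  ultimately show ?thesis by (auto simp: ennreal_le_iff enn2real_nonneg elim!: eventually_mono) (metis ennreal_le_iff enn2real_nonneg)
qed

lemma enn2real_ge_1: "1 \<le> p \<Longrightarrow> p \<noteq> top \<Longrightarrow> 1 \<le> enn2real p"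
  by (metis enn2real_1 enn2real_mono top.not_eq_extremum)

text \<open>A majorant that is both integrable and bounded lies in every conjugate space, so one
  hypothesis serves all p; the argument itself avoids conjugate exponents.\<close>

lemma Lp_mult_integrable:
  assumes f: "f \<in> Lp p" and p: "1 \<le> p" and m: "\<phi> \<in> borel_measurable lebesgue"
    and w: "integrable lebesgue w" and b: "\<And>x. \<bar>\<phi> x\<bar> \<le> w x" "\<And>x. w x \<le> B"
  shows "integrable lebesgue (\<lambda>x. f x * \<phi> x)"
proof -
  have mf: "f \<in> borel_measurable lebesgue" using f by (simp add: Lp_def)
  have w0: "0 \<le> w x" for x using b(1)[of x] by linarith
  show ?thesis
  proof (cases "p = top")
    case True
    define M where "M = enn2real (Lp_norm top f)"
    have AE: "AE x in lebesgue. \<bar>f x\<bar> \<le> M" using Lp_top_bound f True by (simp add: M_def)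
    show ?thesis
    proof (rule Bochner_Integration.integrable_bound)
      show "integrable lebesgue (\<lambda>x. M * w x)" by (intro integrable_mult_right w)
      show "(\<lambda>x. f x * \<phi> x) \<in> borel_measurable lebesgue" by (intro borel_measurable_times mf m)
      show "AE x in lebesgue. norm (f x * \<phi> x) \<le> norm (M * w x)"
        using AE
      proof eventually_elim
        case (elim x)
        then have "\<bar>f x\<bar> * \<bar>\<phi> x\<bar> \<le> \<bar>M\<bar> * \<bar>w x\<bar>"
          using b(1)[of x] w0[of x] by (intro mult_mono) auto
        then show ?case by (simp add: abs_mult)
      qed
    qed
  next
    case False
    define q where "q = enn2real p"
    have q: "1 \<le> q" unfolding q_def using enn2real_ge_1 p False by blast
    show ?thesis
    proof (rule Bochner_Integration.integrable_bound)
      show "integrable lebesgue (\<lambda>x. w x + B * \<bar>f x\<bar> powr q)" unfolding q_def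
        by (intro Bochner_Integration.integrable_add integrable_mult_right w Lp_finite_integrable[OF f False])
      show "(\<lambda>x. f x * \<phi> x) \<in> borel_measurable lebesgue" by (intro borel_measurable_times mf m)
      have "\<bar>f x * \<phi> x\<bar> \<le> w x + B * \<bar>f x\<bar> powr q" for x
      proof -
        \<comment> \<open>As q \<ge> 1, this splits the product into a part dominated by
          \<open>w\<close> and a part dominated by \<open>B\<close> times the q-th power of
          |f|.\<close>
        have "\<bar>f x\<bar> \<le> 1 + \<bar>f x\<bar> powr q"
        proof (cases "\<bar>f x\<bar> \<le> 1")
          case False
          then have "\<bar>f x\<bar> powr 1 \<le> \<bar>f x\<bar> powr q" using q by (intro powr_mono) auto
          then show ?thesis using False by simp
        qed (simp add: add_increasing2)
        then have "\<bar>f x\<bar> * \<bar>\<phi> x\<bar> \<le> (1 + \<bar>f x\<bar> powr q) * w x" using b by (intro mult_mono) auto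
        also have "\<dots> \<le> w x + B * \<bar>f x\<bar> powr q"
          using mult_right_mono[OF b(2)[of x], of "\<bar>f x\<bar> powr q"] by (simp add: algebra_simps)
        finally show ?thesis by (simp add: abs_mult)
      qed
      then show "AE x in lebesgue. norm (f x * \<phi> x) \<le> norm (w x + B * \<bar>f x\<bar> powr q)"
        by (intro AE_I2) (metis abs_ge_self order_trans real_norm_def)
    qed
  qed
qed

lemma Lp_exp_decaying_integrable:
  assumes "f \<in> Lp p" "1 \<le> p" "exp_decaying \<theta>" "a \<noteq> 0"
  shows "integrable lebesgue (\<lambda>x. f x * \<theta> (a * x - b))"
proof -
  obtain C \<gamma> where C: "0 < C" "0 < \<gamma>" "\<And>x. \<bar>\<theta> x\<bar> \<le> C * exp (- \<gamma> * \<bar>x\<bar>)"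
    using assms(3) unfolding exp_decaying_def by blast
  have c: "continuous_on UNIV \<theta>" using assms(3) by (simp add: exp_decaying_def)
  show ?thesis
  proof (rule Lp_mult_integrable[OF assms(1,2)])
    show "(\<lambda>x. \<theta> (a * x - b)) \<in> borel_measurable lebesgue"
      by (intro continuous_lebesgue_measurable continuous_on_compose2[OF c] continuous_intros) auto
    show "integrable lebesgue (\<lambda>x. C * exp (- \<gamma> * \<bar>a * x - b\<bar>))"
      by (intro integrable_mult_right integrable_exp_abs_affine C assms)
    show "\<bar>\<theta> (a * x - b)\<bar> \<le> C * exp (- \<gamma> * \<bar>a * x - b\<bar>)" for x by (rule C)
    show "C * exp (- \<gamma> * \<bar>a * x - b\<bar>) \<le> C" for x using C by simp
  qed
qed

text \<open>Each vanishing moment allows one more integration by parts with a decaying antiderivative.\<close>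

lemma vanishing_moments_pairing:
  assumes "exp_decaying \<psi>" "\<And>\<kappa>. \<kappa> < k \<Longrightarrow> (LINT x|lebesgue. x ^ \<kappa> * \<psi> x) = 0"
  shows "\<exists>\<theta>. exp_decaying \<theta> \<and> (\<forall>h p a b. 1 \<le> p \<longrightarrow> a \<noteq> 0 \<longrightarrow> (\<forall>i\<le>k. h i \<in> Lp p) \<longrightarrow>
    (\<forall>i<k. has_weak_deriv 1 (h i) (h (Suc i))) \<longrightarrow>
    (LINT x|lebesgue. h 0 x * \<psi> (a * x - b)) = (- (1 / a)) ^ k * (LINT x|lebesgue. h k x * \<theta> (a * x - b)))"
  using assms
proof (induction k arbitrary: \<psi>)
  case 0
  then show ?case by (intro exI[of _ \<psi>]) auto
next
  case (Suc k)
  obtain F where F: "exp_decaying F" "\<And>x. (F has_field_derivative \<psi> x) (at x)"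
    using exp_decaying_antiderivative[OF Suc.prems(1)] Suc.prems(2)[of 0] by auto
  have "(LINT x|lebesgue. x ^ \<kappa> * F x) = 0" if "\<kappa> < k" for \<kappa>
    using exp_decaying_moment[OF F(1) Suc.prems(1) F(2), of \<kappa>] Suc.prems(2)[of "Suc \<kappa>"] that
    by (simp del: power_Suc)
  \<comment> \<open>\<theta> is fixed before \<open>h\<close>, \<open>p\<close>, \<open>a\<close>
    and \<open>b\<close>, so a single function serves all scales, shifts and Sobolev
    functions.\<close>
  from Suc.IH[OF F(1) this] obtain \<theta> where \<theta>: "exp_decaying \<theta>"
    and I: "\<And>h p a b. 1 \<le> p \<Longrightarrow> a \<noteq> 0 \<Longrightarrow> (\<forall>i\<le>k. h i \<in> Lp p) \<Longrightarrow>
      (\<forall>i<k. has_weak_deriv 1 (h i) (h (Suc i))) \<Longrightarrow>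
      (LINT x|lebesgue. h 0 x * F (a * x - b)) = (- (1 / a)) ^ k * (LINT x|lebesgue. h k x * \<theta> (a * x - b))"
    by blast
  have c: "continuous_on UNIV \<psi>" using Suc.prems(1) by (simp add: exp_decaying_def)
  have "(LINT x|lebesgue. h 0 x * \<psi> (a * x - b)) =
      (- (1 / a)) ^ Suc k * (LINT x|lebesgue. h (Suc k) x * \<theta> (a * x - b))"
    if p: "1 \<le> p" and a: "a \<noteq> 0" and L: "\<forall>i\<le>Suc k. h i \<in> Lp p"
      and W: "\<forall>i<Suc k. has_weak_deriv 1 (h i) (h (Suc i))" for h p a b
  proof -
    \<comment> \<open>By the chain rule F(a x - b) has derivative a \<psi>(a x - b); dividing by a
      gives one factor -1/a.\<close>
    have "(LINT x|lebesgue. h 0 x * (\<psi> (a * x - b) * a)) = - (LINT x|lebesgue. h 1 x * F (a * x - b))"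
    proof (rule weak_deriv_integration_by_parts)
      show "has_weak_deriv 1 (h 0) (h 1)" using W by auto
      show "((\<lambda>x. F (a * x - b)) has_real_derivative \<psi> (a * x - b) * a) (at x)" for x
        by (rule DERIV_chain2[OF F(2)]) (auto intro!: derivative_eq_intros)
      show "continuous_on UNIV (\<lambda>x. \<psi> (a * x - b) * a)"
        by (intro continuous_on_compose2[OF c] continuous_intros) auto
      show "integrable lebesgue (\<lambda>x. h 0 x * F (a * x - b))" "integrable lebesgue (\<lambda>x. h 1 x * F (a * x - b))"
        using L by (auto intro!: Lp_exp_decaying_integrable p F a)
      have "integrable lebesgue (\<lambda>x. h 0 x * \<psi> (a * x - b))"
        using L by (auto intro!: Lp_exp_decaying_integrable p Suc.prems a)
      from integrable_mult_left[OF this, of a]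
      show "integrable lebesgue (\<lambda>x. h 0 x * (\<psi> (a * x - b) * a))" by (simp add: mult.assoc)
    qed
    then have "(LINT x|lebesgue. h 0 x * \<psi> (a * x - b)) * a = - (LINT x|lebesgue. h 1 x * F (a * x - b))"
      by (simp add: mult.assoc[symmetric])
    \<comment> \<open>The induction hypothesis is applied to the shifted sequence, which starts at
      \<open>h 1\<close>.\<close>
    also have "(LINT x|lebesgue. h 1 x * F (a * x - b)) =
        (- (1 / a)) ^ k * (LINT x|lebesgue. h (Suc k) x * \<theta> (a * x - b))"
      using I[OF p a, of "\<lambda>i. h (Suc i)" b] L W by simp
    finally show ?thesis using a by (simp add: field_simps)
  qed
  with \<theta> show ?case by blast
qed

section \<open>Discrete norms of exponential averages\<close>

lemma lebesgue_integral_exp_abs_affine: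
  fixes a b \<gamma> :: real
  assumes "0 < a"
  shows "a * (LINT x|lebesgue. exp (- \<gamma> * \<bar>a * x - b\<bar>)) = (LINT x|lebesgue. exp (- \<gamma> * \<bar>x\<bar>))"
proof -
  have "(LINT x|lborel. exp (- \<gamma> * \<bar>x\<bar>)) = a * (LINT x|lborel. exp (- \<gamma> * \<bar>a * x - b\<bar>))"
    using lborel_integral_real_affine[of a "\<lambda>x. exp (- \<gamma> * \<bar>x\<bar>)" "- b"] assms by simp
  then show ?thesis by (simp add: integral_completion)
qed

text \<open>The absolute value is injective on each of the two half-lines, so either half is bounded
  by the geometric series 1/(1 - r).\<close>

lemma sum_power_abs_int_le:
  fixes r :: real
  assumes r: "0 < r" "r < 1" and F: "finite F"
  shows "(\<Sum>m\<in>F. r ^ nat \<bar>m\<bar>) \<le> 2 / (1 - r)"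
proof -
  have half: "(\<Sum>m\<in>G. r ^ nat \<bar>m\<bar>) \<le> 1 / (1 - r)" if "finite G" "inj_on (\<lambda>m. nat \<bar>m\<bar>) G" for G
  proof -
    have "(\<Sum>m\<in>G. r ^ nat \<bar>m\<bar>) = (\<Sum>k\<in>(\<lambda>m. nat \<bar>m\<bar>) ` G. r ^ k)"
      using that(2) by (simp add: sum.reindex)
    also have "\<dots> \<le> (\<Sum>k. r ^ k)"
      using that r by (intro sum_le_suminf) auto
    also have "\<dots> = 1 / (1 - r)" using r by (intro suminf_geometric) auto
    finally show ?thesis .
  qed
  have "F = (F \<inter> {0..}) \<union> (F \<inter> {..<0})" by auto
  then have "(\<Sum>m\<in>F. r ^ nat \<bar>m\<bar>) = (\<Sum>m\<in>(F \<inter> {0..}) \<union> (F \<inter> {..<0}). r ^ nat \<bar>m\<bar>)" by simp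
  also have "\<dots> = (\<Sum>m\<in>F \<inter> {0..}. r ^ nat \<bar>m\<bar>) + (\<Sum>m\<in>F \<inter> {..<0}. r ^ nat \<bar>m\<bar>)"
    using F by (intro sum.union_disjoint) auto
  also have "\<dots> \<le> 1 / (1 - r) + 1 / (1 - r)"
    using F by (intro add_mono half) (auto simp: inj_on_def)
  finally show ?thesis by simp
qed

text \<open>Replacing y by its floor costs at most the factor exp(\<gamma>); what remains is part of
  a translated two-sided geometric series, hence the uniformity in y.\<close>

lemma sum_exp_abs_translates_bounded:
  fixes \<gamma> :: real
  assumes "0 < \<gamma>"
  shows "\<exists>S>0. \<forall>y F. finite F \<longrightarrow> (\<Sum>\<mu>\<in>F. exp (- \<gamma> * \<bar>y - of_int \<mu>\<bar>)) \<le> S"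
proof -
  define r where "r = exp (- \<gamma>)"
  have r: "0 < r" "r < 1" using assms by (auto simp: r_def)
  have "(\<Sum>\<mu>\<in>F. exp (- \<gamma> * \<bar>y - of_int \<mu>\<bar>)) \<le> exp \<gamma> * (2 / (1 - r))" if F: "finite F" for y F
  proof -
    have "exp (- \<gamma> * \<bar>y - of_int \<mu>\<bar>) \<le> exp \<gamma> * r ^ nat \<bar>\<mu> - \<lfloor>y\<rfloor>\<bar>" for \<mu>
    proof -
      have "real (nat \<bar>\<mu> - \<lfloor>y\<rfloor>\<bar>) = \<bar>of_int \<mu> - of_int \<lfloor>y\<rfloor>\<bar>" by simp
      also have "\<dots> \<le> \<bar>y - of_int \<mu>\<bar> + 1" by linarith
      finally have "\<gamma> * real (nat \<bar>\<mu> - \<lfloor>y\<rfloor>\<bar>) \<le> \<gamma> * (\<bar>y - of_int \<mu>\<bar> + 1)"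
        using assms by (intro mult_left_mono) auto
      then have "- \<gamma> * \<bar>y - of_int \<mu>\<bar> \<le> \<gamma> + real (nat \<bar>\<mu> - \<lfloor>y\<rfloor>\<bar>) * - \<gamma>"
        by (simp add: algebra_simps)
      then have "exp (- \<gamma> * \<bar>y - of_int \<mu>\<bar>) \<le> exp (\<gamma> + real (nat \<bar>\<mu> - \<lfloor>y\<rfloor>\<bar>) * - \<gamma>)"
        by (simp only: exp_le_cancel_iff)
      then show ?thesis by (simp only: r_def exp_add exp_of_nat_mult)
    qed
    then have "(\<Sum>\<mu>\<in>F. exp (- \<gamma> * \<bar>y - of_int \<mu>\<bar>)) \<le> exp \<gamma> * (\<Sum>\<mu>\<in>F. r ^ nat \<bar>\<mu> - \<lfloor>y\<rfloor>\<bar>)"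
      unfolding sum_distrib_left by (intro sum_mono)
    also have "(\<Sum>\<mu>\<in>F. r ^ nat \<bar>\<mu> - \<lfloor>y\<rfloor>\<bar>) = (\<Sum>m\<in>(\<lambda>\<mu>. \<mu> - \<lfloor>y\<rfloor>) ` F. r ^ nat \<bar>m\<bar>)"
      by (subst sum.reindex) (auto simp: inj_on_def)
    also have "exp \<gamma> * \<dots> \<le> exp \<gamma> * (2 / (1 - r))"
      using F r by (intro mult_left_mono sum_power_abs_int_le) auto
    finally show ?thesis .
  qed
  moreover have "0 < exp \<gamma> * (2 / (1 - r))" using r by simp
  ultimately show ?thesis by blast
qed

text \<open>Hoelder with a worse constant: integrate \<open>\<bar>g\<bar> \<le> t + t powr (1 - q) * \<bar>g\<bar> powr q\<close> and choose \<open>t\<close>.\<close>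

lemma weighted_integral_powr_le:
  fixes g w :: "'a \<Rightarrow> real"
  assumes q: "1 \<le> q" and w: "integrable M w" "\<And>x. 0 \<le> w x"
    and iq: "integrable M (\<lambda>x. \<bar>g x\<bar> powr q * w x)" and i1: "integrable M (\<lambda>x. \<bar>g x\<bar> * w x)"
  shows "(LINT x|M. \<bar>g x\<bar> * w x) powr q \<le> (LINT x|M. \<bar>g x\<bar> powr q * w x) * (1 + (LINT x|M. w x)) powr q"
proof -
  define A where "A = (LINT x|M. \<bar>g x\<bar> powr q * w x)"
  define N where "N = (LINT x|M. \<bar>g x\<bar> * w x)"
  define W where "W = (LINT x|M. w x)"
  have nn: "0 \<le> A" "0 \<le> N" "0 \<le> W" by (simp_all add: A_def N_def W_def w)
  \<comment> \<open>Where |g| > t, one has |g| = |g|^(1-q) |g|^q \<le> t^(1-q) |g|^q because 1 - q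
    \<le> 0.\<close>
  have split: "N \<le> t * W + t powr (1 - q) * A" if t: "0 < t" for t
  proof -
    have "\<bar>g x\<bar> * w x \<le> t * w x + t powr (1 - q) * (\<bar>g x\<bar> powr q * w x)" for x
    proof -
      have "\<bar>g x\<bar> \<le> t + t powr (1 - q) * \<bar>g x\<bar> powr q"
      proof (cases "\<bar>g x\<bar> \<le> t")
        case False
        have "t powr (q - 1) \<le> \<bar>g x\<bar> powr (q - 1)" using q t False by (intro powr_mono2) auto
        then have "t powr (1 - q) * t powr (q - 1) * \<bar>g x\<bar> \<le> t powr (1 - q) * \<bar>g x\<bar> powr (q - 1) * \<bar>g x\<bar>"
          by (intro mult_right_mono mult_left_mono) auto
        moreover have "t powr (1 - q) * t powr (q - 1) = 1" using t by (simp add: powr_add[symmetric])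
        moreover have "\<bar>g x\<bar> powr (q - 1) * \<bar>g x\<bar> = \<bar>g x\<bar> powr q"
          using powr_add[of "\<bar>g x\<bar>" "q - 1" 1] False t by simp
        ultimately have "\<bar>g x\<bar> \<le> t powr (1 - q) * \<bar>g x\<bar> powr q" by (simp add: mult.assoc)
        then show ?thesis using t by simp
      qed (simp add: add_increasing2)
      from mult_right_mono[OF this w(2)[of x]] show ?thesis by (simp add: algebra_simps)
    qed
    then have "N \<le> (LINT x|M. t * w x + t powr (1 - q) * (\<bar>g x\<bar> powr q * w x))"
      unfolding N_def
      by (intro integral_mono i1 Bochner_Integration.integrable_add integrable_mult_right w iq)
    also have "\<dots> = t * W + t powr (1 - q) * A"
      unfolding W_def A_def by (subst Bochner_Integration.integral_add) (auto intro!: integrable_mult_right w iq)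
    finally show ?thesis .
  qed
  have "N powr q \<le> A * (1 + W) powr q"
  proof (cases "A = 0")
    case True
    have "N \<le> 0"
    proof (rule ccontr)
      assume "\<not> N \<le> 0"
      \<comment> \<open>For A = 0 the value A^(1/q) is not an admissible t; this positive one gives
        N \<le> N/2, absurd for N > 0.\<close>
      then have "0 < N / (2 * (1 + W))" using nn by simp
      from split[OF this] have "N \<le> N / 2 * (W / (1 + W))" using True by simp
      also have "\<dots> \<le> N / 2 * 1" using nn by (intro mult_left_mono) auto
      finally show False using \<open>\<not> N \<le> 0\<close> by simp
    qed
    then show ?thesis using nn True by simp
  next
    case False
    then have A: "0 < A" using nn by simp
    \<comment> \<open>The choice t = A^(1/q) balances the two terms: both become multiples of
      A^(1/q).\<close>
    have "(A powr (1 / q)) powr (1 - q) * A = A powr (1 / q * (1 - q) + 1)"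
      using A by (simp add: powr_powr powr_add)
    also have "1 / q * (1 - q) + 1 = 1 / q" using q by (simp add: field_simps)
    finally have "N \<le> A powr (1 / q) * (1 + W)"
      using split[of "A powr (1 / q)"] A by (simp add: algebra_simps)
    then have "N powr q \<le> (A powr (1 / q) * (1 + W)) powr q"
      using nn q by (intro powr_mono2) auto
    also have "\<dots> = A * (1 + W) powr q"
      using nn q by (simp add: powr_mult powr_powr)
    finally show ?thesis .
  qed
  then show ?thesis by (simp add: A_def N_def W_def)
qed

section \<open>Extended-valued norms in terms of real integrals and finite sums\<close>

lemma ennreal_powr_le:
  assumes "X \<le> ennreal Y" "0 \<le> Y" "0 \<le> s"
  shows "ennreal_powr X s \<le> ennreal (Y powr s)"
proof -
  have "X \<noteq> top" using assms(1) by (auto simp: top_unique)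
  moreover have "enn2real X \<le> Y" using assms by (metis enn2real_ennreal enn2real_mono ennreal_less_top)
  ultimately show ?thesis
    using assms by (auto simp: ennreal_powr_def intro!: ennreal_leI powr_mono2)
qed

lemma enn2real_inverse:
  assumes "1 \<le> p" "p \<noteq> top"
  shows "enn2real (1 / p) = 1 / enn2real p"
proof -
  have "p = ennreal (enn2real p)" using assms(2) by (simp add: less_top)
  moreover have "0 < enn2real p" using enn2real_ge_1[OF assms] by simp
  ultimately have "1 / p = ennreal (1 / enn2real p)"
    by (metis divide_ennreal ennreal_1 less_imp_le zero_le_one)
  then show ?thesis by (simp add: enn2real_nonneg)
qed

lemma Lp_norm_finite_eq:
  assumes "f \<in> Lp p" "p \<noteq> top"
  shows "Lp_norm p f = ennreal ((LINT x|lebesgue. \<bar>f x\<bar> powr enn2real p) powr (1 / enn2real p))"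
proof -
  have "(\<integral>\<^sup>+x. ennreal (\<bar>f x\<bar> powr enn2real p) \<partial>lebesgue) =
      ennreal (LINT x|lebesgue. \<bar>f x\<bar> powr enn2real p)"
    by (intro nn_integral_eq_integral Lp_finite_integrable assms) simp
  then show ?thesis
    using assms(2) by (simp add: Lp_norm_def ennreal_powr_def)
qed

lemma lp_norm_finite_le:
  assumes p: "1 \<le> p" "p \<noteq> top" and "0 \<le> Y"
    and le: "\<And>F. finite F \<Longrightarrow> (\<Sum>\<mu>\<in>F. \<bar>u \<mu>\<bar> powr enn2real p) \<le> Y"
  shows "lp_norm p u \<le> ennreal (Y powr (1 / enn2real p))"
proof -
  have "(\<Sum>\<^sub>\<infinity>\<mu>. ennreal (\<bar>u \<mu>\<bar> powr enn2real p)) \<le> ennreal Y"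
  proof (rule infsum_le_finite_sums)
    show "(\<Sum>\<mu>\<in>F. ennreal (\<bar>u \<mu>\<bar> powr enn2real p)) \<le> ennreal Y" if "finite F" for F
      using le[OF that] by (simp add: sum_ennreal ennreal_leI)
  qed (simp add: nonneg_summable_on_complete)
  from ennreal_powr_le[OF this \<open>0 \<le> Y\<close>, of "1 / enn2real p"]
  show ?thesis using p by (simp add: lp_norm_def)
qed

text \<open>The kernels a exp(-\<gamma> |a x - \<mu>|) have the same mass W for all a and \<mu>,
  which controls each average. At every x their sum over \<mu> is at most a S, which bounds the sum
  of q-th powers by a multiple of a; the q-th root yields the power 1/p. The constant depends on
  \<gamma> and p only.\<close>

lemma lp_norm_exp_average_le:
  fixes \<gamma> :: real
  assumes \<gamma>: "0 < \<gamma>" and p: "1 \<le> p"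
  shows "\<exists>K>0. \<forall>a>0. \<forall>D\<ge>0. \<forall>g\<in>Lp p. \<forall>u.
    (\<forall>\<mu>::int. \<bar>u \<mu>\<bar> \<le> D * (a * (LINT x|lebesgue. \<bar>g x\<bar> * exp (- \<gamma> * \<bar>a * x - of_int \<mu>\<bar>)))) \<longrightarrow>
    lp_norm p u \<le> ennreal (K * D * a powr enn2real (1 / p)) * Lp_norm p g"
proof -
  define W where "W = (LINT x|lebesgue. exp (- \<gamma> * \<bar>x\<bar>))"
  have W0: "0 \<le> W" unfolding W_def by simp
  have Wa: "a * (LINT x|lebesgue. exp (- \<gamma> * \<bar>a * x - b\<bar>)) = W" if "0 < a" for a b
    using lebesgue_integral_exp_abs_affine[OF that] by (simp add: W_def)
  have iw: "integrable lebesgue (\<lambda>x. exp (- \<gamma> * \<bar>a * x - b\<bar>))" if "0 < a" for a b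
    using that by (intro integrable_exp_abs_affine \<gamma>) auto
  have mw: "(\<lambda>x. exp (- \<gamma> * \<bar>a * x - b\<bar>)) \<in> borel_measurable lebesgue" for a b
    by (intro continuous_lebesgue_measurable continuous_intros)
  have ig: "integrable lebesgue (\<lambda>x. \<bar>g x\<bar> * exp (- \<gamma> * \<bar>a * x - b\<bar>))"
    if "0 < a" "g \<in> Lp p" for a b g
  proof -
    have "integrable lebesgue (\<lambda>x. g x * exp (- \<gamma> * \<bar>a * x - b\<bar>))"
      by (rule Lp_mult_integrable[OF that(2) p mw iw[OF that(1)], where B = 1]) (use \<gamma> in auto)
    from integrable_abs[OF this] show ?thesis by (simp add: abs_mult)
  qed
  show ?thesis
  proof (cases "p = top")
    case True
    \<comment> \<open>The summand 1 makes the positivity of the constant immediate.\<close>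
    have "lp_norm p u \<le> ennreal ((W + 1) * D * a powr enn2real (1 / p)) * Lp_norm p g"
      if a: "0 < a" and D: "0 \<le> D" and g: "g \<in> Lp p"
        and u: "\<forall>\<mu>::int. \<bar>u \<mu>\<bar> \<le> D * (a * (LINT x|lebesgue. \<bar>g x\<bar> * exp (- \<gamma> * \<bar>a * x - of_int \<mu>\<bar>)))"
      for a D g u
    proof -
      define M where "M = enn2real (Lp_norm top g)"
      have M0: "0 \<le> M" by (simp add: M_def enn2real_nonneg)
      have "Lp_norm top g < top" using g True by (simp add: Lp_def)
      then have M: "Lp_norm top g = ennreal M" by (simp add: M_def)
      have AE: "AE x in lebesgue. \<bar>g x\<bar> \<le> M" using Lp_top_bound g True by (simp add: M_def)
      have "\<bar>u \<mu>\<bar> \<le> (W + 1) * D * M" for \<mu>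
      proof -
        have "(LINT x|lebesgue. \<bar>g x\<bar> * exp (- \<gamma> * \<bar>a * x - of_int \<mu>\<bar>)) \<le>
            (LINT x|lebesgue. M * exp (- \<gamma> * \<bar>a * x - of_int \<mu>\<bar>))"
          by (intro integral_mono_AE ig a g integrable_mult_right iw) (use AE in \<open>auto elim!: eventually_mono\<close>)
        then have "D * (a * (LINT x|lebesgue. \<bar>g x\<bar> * exp (- \<gamma> * \<bar>a * x - of_int \<mu>\<bar>))) \<le>
            D * (a * (LINT x|lebesgue. M * exp (- \<gamma> * \<bar>a * x - of_int \<mu>\<bar>)))"
          using D a by (intro mult_left_mono) auto
        also have "\<dots> = D * M * (a * (LINT x|lebesgue. exp (- \<gamma> * \<bar>a * x - of_int \<mu>\<bar>)))" by simp
        also have "\<dots> = D * M * W" by (simp only: Wa[OF a])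
        also have "\<dots> \<le> (W + 1) * D * M" using D M0 by (simp add: algebra_simps)
        finally show ?thesis using u by (meson order_trans)
      qed
      then have "lp_norm p u \<le> ennreal ((W + 1) * D * M)"
        using True by (auto simp: lp_norm_def intro!: SUP_least ennreal_leI)
      \<comment> \<open>Here 1/p = 0, so the power of a equals 1 and may be inserted.\<close>
      also have "\<dots> = ennreal ((W + 1) * D * a powr enn2real (1 / p)) * Lp_norm p g"
        using True a W0 D M0 M by (simp add: ennreal_mult)
      finally show ?thesis .
    qed
    then show ?thesis using W0 by (intro exI[of _ "W + 1"]) auto
  next
    case False
    define q where "q = enn2real p"
    have q: "1 \<le> q" unfolding q_def by (rule enn2real_ge_1[OF p False])
    obtain S where S: "0 < S" "\<And>y F. finite F \<Longrightarrow> (\<Sum>\<mu>\<in>F. exp (- \<gamma> * \<bar>y - of_int \<mu>\<bar>)) \<le> S"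
      using sum_exp_abs_translates_bounded[OF \<gamma>] by blast
    \<comment> \<open>S comes from summing the translates, 1 + W from the weighted integral
      inequality, both after the q-th root.\<close>
    define K where "K = S powr (1 / q) * (1 + W)"
    have K: "0 < K" using S W0 by (auto simp: K_def)
    have "lp_norm p u \<le> ennreal (K * D * a powr enn2real (1 / p)) * Lp_norm p g"
      if a: "0 < a" and D: "0 \<le> D" and g: "g \<in> Lp p"
        and u: "\<forall>\<mu>::int. \<bar>u \<mu>\<bar> \<le> D * (a * (LINT x|lebesgue. \<bar>g x\<bar> * exp (- \<gamma> * \<bar>a * x - of_int \<mu>\<bar>)))"
      for a D g u
    proof -
      define w where "w \<mu> x = exp (- \<gamma> * \<bar>a * x - of_int \<mu>\<bar>)" for \<mu> :: int and x
      define G where "G = (LINT x|lebesgue. \<bar>g x\<bar> powr q)"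
      have G0: "0 \<le> G" unfolding G_def by (intro integral_nonneg_AE) auto
      have iG: "integrable lebesgue (\<lambda>x. \<bar>g x\<bar> powr q)"
        unfolding q_def by (rule Lp_finite_integrable[OF g False])
      have iq: "integrable lebesgue (\<lambda>x. \<bar>g x\<bar> powr q * w \<mu> x)" for \<mu>
      proof (rule Bochner_Integration.integrable_bound[OF iG])
        show "(\<lambda>x. \<bar>g x\<bar> powr q * w \<mu> x) \<in> borel_measurable lebesgue"
          unfolding w_def by (intro borel_measurable_times mw borel_measurable_integrable[OF iG])
        have "\<bar>g x\<bar> powr q * w \<mu> x \<le> \<bar>g x\<bar> powr q * 1" for x
          using \<gamma> by (intro mult_left_mono) (auto simp: w_def)
        then show "AE x in lebesgue. norm (\<bar>g x\<bar> powr q * w \<mu> x) \<le> norm (\<bar>g x\<bar> powr q)"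
          by (simp add: w_def)
      qed
      have each: "\<bar>u \<mu>\<bar> powr q \<le> D powr q * (1 + W) powr q * a * (LINT x|lebesgue. \<bar>g x\<bar> powr q * w \<mu> x)" for \<mu>
      proof -
        \<comment> \<open>The factor a is moved into the weight, whose mass is then W at every
          scale; left outside, it would make the factor 1 + mass depend on a.\<close>
        have "\<bar>u \<mu>\<bar> \<le> D * (LINT x|lebesgue. \<bar>g x\<bar> * (a * w \<mu> x))"
          using u[rule_format, of \<mu>] by (simp add: w_def mult.left_commute)
        then have "\<bar>u \<mu>\<bar> powr q \<le> (D * (LINT x|lebesgue. \<bar>g x\<bar> * (a * w \<mu> x))) powr q"
          using q by (intro powr_mono2) auto
        also have "\<dots> = D powr q * (LINT x|lebesgue. \<bar>g x\<bar> * (a * w \<mu> x)) powr q"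
          by (rule powr_mult)
        also have "\<dots> \<le> D powr q * ((LINT x|lebesgue. \<bar>g x\<bar> powr q * (a * w \<mu> x)) *
            (1 + (LINT x|lebesgue. a * w \<mu> x)) powr q)"
        proof (intro mult_left_mono weighted_integral_powr_le q)
          show "integrable lebesgue (\<lambda>x. a * w \<mu> x)"
            unfolding w_def by (intro integrable_mult_right iw a)
          show "integrable lebesgue (\<lambda>x. \<bar>g x\<bar> powr q * (a * w \<mu> x))"
            using integrable_mult_right[OF iq, of a \<mu>] by (simp add: mult.left_commute)
          show "integrable lebesgue (\<lambda>x. \<bar>g x\<bar> * (a * w \<mu> x))"
            using integrable_mult_right[OF ig[OF a g], of a "of_int \<mu>"] by (simp add: mult.left_commute w_def)
        qed (use a in \<open>auto simp: w_def\<close>)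
        also have "(LINT x|lebesgue. a * w \<mu> x) = W" using Wa[OF a] by (simp add: w_def)
        finally show ?thesis by (simp add: mult_ac)
      qed
      have "(\<Sum>\<mu>\<in>F. \<bar>u \<mu>\<bar> powr q) \<le> D powr q * (1 + W) powr q * a * (S * G)" if F: "finite F" for F
      proof -
        have "(\<Sum>\<mu>\<in>F. (LINT x|lebesgue. \<bar>g x\<bar> powr q * w \<mu> x)) = (LINT x|lebesgue. (\<Sum>\<mu>\<in>F. \<bar>g x\<bar> powr q * w \<mu> x))"
          by (rule Bochner_Integration.integral_sum[symmetric]) (rule iq)
        also have "\<dots> \<le> (LINT x|lebesgue. S * \<bar>g x\<bar> powr q)"
        proof (intro integral_mono Bochner_Integration.integrable_sum iq integrable_mult_right iG)
          \<comment> \<open>The bound on translates is used pointwise at y = a x, which is why it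
            had to be uniform in y.\<close>
          show "(\<Sum>\<mu>\<in>F. \<bar>g x\<bar> powr q * w \<mu> x) \<le> S * \<bar>g x\<bar> powr q" for x
            using mult_left_mono[OF S(2)[OF F, of "a * x"], of "\<bar>g x\<bar> powr q"]
            by (simp add: sum_distrib_left w_def mult.commute)
        qed
        also have "\<dots> = S * G" by (simp add: G_def)
        finally have "D powr q * (1 + W) powr q * a * (\<Sum>\<mu>\<in>F. (LINT x|lebesgue. \<bar>g x\<bar> powr q * w \<mu> x)) \<le>
            D powr q * (1 + W) powr q * a * (S * G)"
          using a by (intro mult_left_mono) auto
        moreover have "(\<Sum>\<mu>\<in>F. \<bar>u \<mu>\<bar> powr q) \<le>
            D powr q * (1 + W) powr q * a * (\<Sum>\<mu>\<in>F. (LINT x|lebesgue. \<bar>g x\<bar> powr q * w \<mu> x))"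
          unfolding sum_distrib_left by (intro sum_mono each)
        ultimately show ?thesis by linarith
      qed
      then have "lp_norm p u \<le> ennreal ((D powr q * (1 + W) powr q * a * (S * G)) powr (1 / q))"
        unfolding q_def using a S G0 by (intro lp_norm_finite_le p False) (auto simp: q_def)
      also have "(D powr q * (1 + W) powr q * a * (S * G)) powr (1 / q) =
          K * D * a powr (1 / q) * G powr (1 / q)"
        using a S G0 D W0 q by (simp add: powr_mult powr_powr K_def mult_ac)
      also have "ennreal \<dots> = ennreal (K * D * a powr enn2real (1 / p)) * Lp_norm p g"
        using K D by (simp add: Lp_norm_finite_eq[OF g False] enn2real_inverse[OF p False] ennreal_mult G_def q_def)
      finally show ?thesis .
    qed
    then show ?thesis using K by blast
  qed
qed

section \<open>Test spaces and the embedding\<close>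

lemma C_class_iterated_deriv:
  assumes "f \<in> C_class r"
  shows "k < r \<Longrightarrow> ((deriv ^^ k) f has_field_derivative (deriv ^^ Suc k) f x) (at x)"
    and "k \<le> r \<Longrightarrow> continuous_on UNIV ((deriv ^^ k) f)"
proof -
  show d: "((deriv ^^ k) f has_field_derivative (deriv ^^ Suc k) f x) (at x)" if "k < r" for k x
    using assms that by (simp add: C_class_def field_differentiable_derivI)
  show "continuous_on UNIV ((deriv ^^ k) f)" if "k \<le> r"
  proof (cases "k = r")
    case False
    then show ?thesis
      using d that by (meson DERIV_isCont continuous_at_imp_continuous_on le_neq_implies_less)
  qed (use assms in \<open>simp add: C_class_def\<close>)
qed

lemma C_classI:
  assumes "\<And>k x. k < r \<Longrightarrow> ((deriv ^^ k) f has_field_derivative F k x) (at x)"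
    and "continuous_on UNIV ((deriv ^^ r) f)"
  shows "f \<in> C_class r"
  using assms by (auto simp: C_class_def field_differentiable_def)

lemma iterated_deriv_linear:
  assumes \<phi>: "\<phi> \<in> C_class r" and \<eta>: "\<eta> \<in> C_class r"
  shows "k \<le> r \<Longrightarrow> (deriv ^^ k) (\<lambda>x. a * \<phi> x + b * \<eta> x) = (\<lambda>x. a * (deriv ^^ k) \<phi> x + b * (deriv ^^ k) \<eta> x)"
proof (induction k)
  case (Suc k)
  then have IH: "(deriv ^^ k) (\<lambda>x. a * \<phi> x + b * \<eta> x) = (\<lambda>x. a * (deriv ^^ k) \<phi> x + b * (deriv ^^ k) \<eta> x)"
    and k: "k < r" by simp_all
  have "((\<lambda>x. a * (deriv ^^ k) \<phi> x + b * (deriv ^^ k) \<eta> x) has_field_derivative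
      a * (deriv ^^ Suc k) \<phi> x + b * (deriv ^^ Suc k) \<eta> x) (at x)" for x
    by (intro DERIV_add DERIV_cmult C_class_iterated_deriv(1)[OF \<phi> k] C_class_iterated_deriv(1)[OF \<eta> k])
  then have "deriv ((deriv ^^ k) (\<lambda>x. a * \<phi> x + b * \<eta> x)) x =
      a * (deriv ^^ Suc k) \<phi> x + b * (deriv ^^ Suc k) \<eta> x" for x
    unfolding IH by (rule DERIV_imp_deriv)
  then show ?case by (auto simp: fun_eq_iff)
qed simp

lemma C_class_linear:
  assumes \<phi>: "\<phi> \<in> C_class r" and \<eta>: "\<eta> \<in> C_class r"
  shows "(\<lambda>x. a * \<phi> x + b * \<eta> x) \<in> C_class r"
proof (rule C_classI)
  show "((deriv ^^ k) (\<lambda>x. a * \<phi> x + b * \<eta> x) has_field_derivative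
      a * (deriv ^^ Suc k) \<phi> x + b * (deriv ^^ Suc k) \<eta> x) (at x)" if k: "k < r" for k x
    unfolding iterated_deriv_linear[OF \<phi> \<eta> less_imp_le[OF k]]
    by (intro DERIV_add DERIV_cmult C_class_iterated_deriv(1)[OF \<phi> k] C_class_iterated_deriv(1)[OF \<eta> k])
  show "continuous_on UNIV ((deriv ^^ r) (\<lambda>x. a * \<phi> x + b * \<eta> x))"
    unfolding iterated_deriv_linear[OF \<phi> \<eta> order_refl]
    by (intro continuous_intros C_class_iterated_deriv(2)[OF \<phi>] C_class_iterated_deriv(2)[OF \<eta>]) auto
qed

lemma has_derivative_iterated_affine:
  assumes \<phi>: "\<phi> \<in> C_class r" and k: "k < r"
  shows "((\<lambda>x. a ^ k * (deriv ^^ k) \<phi> (a * x - b)) has_field_derivative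
      a ^ Suc k * (deriv ^^ Suc k) \<phi> (a * x - b)) (at x)"
proof -
  have "((\<lambda>x. a * x - b) has_field_derivative a) (at x)" by (auto intro!: derivative_eq_intros)
  from DERIV_cmult[OF DERIV_chain2[OF C_class_iterated_deriv(1)[OF \<phi> k] this], of "a ^ k"]
  show ?thesis by (simp add: mult_ac)
qed

lemma iterated_deriv_affine:
  assumes \<phi>: "\<phi> \<in> C_class r"
  shows "k \<le> r \<Longrightarrow> (deriv ^^ k) (\<lambda>x. \<phi> (a * x - b)) = (\<lambda>x. a ^ k * (deriv ^^ k) \<phi> (a * x - b))"
proof (induction k)
  case (Suc k)
  then have IH: "(deriv ^^ k) (\<lambda>x. \<phi> (a * x - b)) = (\<lambda>x. a ^ k * (deriv ^^ k) \<phi> (a * x - b))"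
    and k: "k < r" by simp_all
  have "deriv ((deriv ^^ k) (\<lambda>x. \<phi> (a * x - b))) x = a ^ Suc k * (deriv ^^ Suc k) \<phi> (a * x - b)" for x
    unfolding IH by (rule DERIV_imp_deriv[OF has_derivative_iterated_affine[OF \<phi> k]])
  then show ?case by (auto simp: fun_eq_iff)
qed simp

lemma C_class_affine:
  assumes \<phi>: "\<phi> \<in> C_class r"
  shows "(\<lambda>x. \<phi> (a * x - b)) \<in> C_class r"
proof (rule C_classI)
  show "((deriv ^^ k) (\<lambda>x. \<phi> (a * x - b)) has_field_derivative
      a ^ Suc k * (deriv ^^ Suc k) \<phi> (a * x - b)) (at x)" if k: "k < r" for k x
    unfolding iterated_deriv_affine[OF \<phi> less_imp_le[OF k]]
    by (rule has_derivative_iterated_affine[OF \<phi> k])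
  show "continuous_on UNIV ((deriv ^^ r) (\<lambda>x. \<phi> (a * x - b)))"
    unfolding iterated_deriv_affine[OF \<phi> order_refl]
    by (intro continuous_intros continuous_on_compose2[OF C_class_iterated_deriv(2)[OF \<phi>]]) auto
qed

text \<open>For l \<ge> 0 an exponential is compared with polynomial decay; for l < 0 the power on
  the right is at least 1. The constant \<open>M + 1\<close> serves both cases.\<close>

lemma exp_le_power_int:
  fixes \<delta> :: real and l :: int
  assumes "0 < \<delta>"
  shows "\<exists>M>0. \<forall>t\<ge>0. exp (- \<delta> * t) \<le> M * (1 + t) powi (- l)"
proof -
  obtain M where M: "0 < M" "\<And>t. 0 \<le> t \<Longrightarrow> (1 + t) ^ nat l \<le> M * exp (\<delta> * t)"
    using power_le_exp[OF assms, of "nat l"] by blast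
  have "exp (- \<delta> * t) \<le> (M + 1) * (1 + t) powi (- l)" if t: "0 \<le> t" for t
  proof (cases "0 \<le> l")
    case True
    have eq: "(1 + t) powi (- l) = inverse ((1 + t) ^ nat l)"
      using True by (cases "l = 0") (auto simp: power_int_def power_inverse)
    have "exp (- \<delta> * t) \<le> M * inverse ((1 + t) ^ nat l)"
      using M(2)[OF t] t by (simp add: exp_minus field_simps add_pos_nonneg)
    moreover have "0 \<le> inverse ((1 + t) ^ nat l)" using t by simp
    ultimately show ?thesis unfolding eq distrib_right mult_1 by linarith
  next
    case False
    have "exp (- \<delta> * t) \<le> 1" using assms t by simp
    also have "1 \<le> (1 + t) ^ nat (- l)" using t by (intro one_le_power) auto
    also have "\<dots> \<le> (M + 1) * (1 + t) ^ nat (- l)" using t M(1) by (intro mult_le_cancel_right1[THEN iffD2]) auto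
    also have "(1 + t) ^ nat (- l) = (1 + t) powi (- l)" using False by (simp add: power_int_def)
    finally show ?thesis .
  qed
  then show ?thesis using M(1) by (intro exI[of _ "M + 1"]) auto
qed

text \<open>Since |a| |x| \<le> |a x - c| + |c|, the substitution changes the rate to \<gamma> |a|
  and costs exp(\<gamma> |c|). The dependence on a and c is harmless, as only membership is
  claimed.\<close>

lemma S_space_affine:
  assumes \<phi>: "\<phi> \<in> C_class r" and a: "a \<noteq> 0" and C: "0 \<le> C" "0 < \<gamma>"
    and b: "\<And>k x. k \<le> r \<Longrightarrow> \<bar>(deriv ^^ k) \<phi> x\<bar> \<le> C * exp (- \<gamma> * \<bar>x\<bar>)"
  shows "(\<lambda>x. \<phi> (a * x - c)) \<in> S_space r"
proof -
  have "\<exists>C'>0. \<forall>x. \<bar>(deriv ^^ k) (\<lambda>x. \<phi> (a * x - c)) x\<bar> \<le> C' * (1 + \<bar>x\<bar>) powi (- l)"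
    if k: "k \<le> r" for k and l :: int
  proof -
    obtain M where M: "0 < M" "\<And>t. 0 \<le> t \<Longrightarrow> exp (- (\<gamma> * \<bar>a\<bar>) * t) \<le> M * (1 + t) powi (- l)"
      using exp_le_power_int[of "\<gamma> * \<bar>a\<bar>" l] C a by auto
    let ?C = "\<bar>a\<bar> ^ k * (C * exp (\<gamma> * \<bar>c\<bar>)) * M"
    have "\<bar>(deriv ^^ k) (\<lambda>x. \<phi> (a * x - c)) x\<bar> \<le> (?C + 1) * (1 + \<bar>x\<bar>) powi (- l)" for x
    proof -
      have "\<bar>a\<bar> * \<bar>x\<bar> \<le> \<bar>a * x - c\<bar> + \<bar>c\<bar>" unfolding abs_mult[symmetric] by linarith
      then have "\<gamma> * (\<bar>a\<bar> * \<bar>x\<bar>) \<le> \<gamma> * (\<bar>a * x - c\<bar> + \<bar>c\<bar>)" using C by (intro mult_left_mono) auto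
      then have "exp (- \<gamma> * \<bar>a * x - c\<bar>) \<le> exp (\<gamma> * \<bar>c\<bar> + - (\<gamma> * \<bar>a\<bar>) * \<bar>x\<bar>)"
        by (simp add: algebra_simps)
      also have "\<dots> \<le> exp (\<gamma> * \<bar>c\<bar>) * (M * (1 + \<bar>x\<bar>) powi (- l))"
        unfolding exp_add by (intro mult_left_mono M(2)) auto
      finally have le: "exp (- \<gamma> * \<bar>a * x - c\<bar>) \<le> exp (\<gamma> * \<bar>c\<bar>) * (M * (1 + \<bar>x\<bar>) powi (- l))" .
      have "\<bar>(deriv ^^ k) (\<lambda>x. \<phi> (a * x - c)) x\<bar> \<le> \<bar>a\<bar> ^ k * (C * exp (- \<gamma> * \<bar>a * x - c\<bar>))"
        unfolding iterated_deriv_affine[OF \<phi> k] abs_mult power_abs by (intro mult_left_mono b k) auto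
      also have "\<dots> \<le> \<bar>a\<bar> ^ k * (C * (exp (\<gamma> * \<bar>c\<bar>) * (M * (1 + \<bar>x\<bar>) powi (- l))))"
        using C(1) by (intro mult_left_mono le) auto
      also have "\<dots> = ?C * (1 + \<bar>x\<bar>) powi (- l)" by simp
      also have "\<dots> \<le> (?C + 1) * (1 + \<bar>x\<bar>) powi (- l)" by (intro mult_right_mono) auto
      finally show ?thesis .
    qed
    moreover have "0 < ?C + 1" using C M by (simp add: add_nonneg_pos)
    ultimately show ?thesis by blast
  qed
  then show ?thesis using C_class_affine[OF \<phi>] by (simp add: S_space_def)
qed

lemma S_space_linear:
  assumes \<phi>: "\<phi> \<in> S_space r" and \<eta>: "\<eta> \<in> S_space r"
  shows "(\<lambda>x. a * \<phi> x + b * \<eta> x) \<in> S_space r"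
proof -
  have C: "\<phi> \<in> C_class r" "\<eta> \<in> C_class r" using assms by (auto simp: S_space_def)
  have "\<exists>C>0. \<forall>x. \<bar>(deriv ^^ k) (\<lambda>x. a * \<phi> x + b * \<eta> x) x\<bar> \<le> C * (1 + \<bar>x\<bar>) powi (- l)"
    if k: "k \<le> r" for k and l :: int
  proof -
    obtain A B where A: "0 < A" "\<And>x. \<bar>(deriv ^^ k) \<phi> x\<bar> \<le> A * (1 + \<bar>x\<bar>) powi (- l)"
      and B: "0 < B" "\<And>x. \<bar>(deriv ^^ k) \<eta> x\<bar> \<le> B * (1 + \<bar>x\<bar>) powi (- l)"
      using assms k unfolding S_space_def by blast
    have "\<bar>(deriv ^^ k) (\<lambda>x. a * \<phi> x + b * \<eta> x) x\<bar> \<le> (\<bar>a\<bar> * A + \<bar>b\<bar> * B + 1) * (1 + \<bar>x\<bar>) powi (- l)" for x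
    proof -
      have "\<bar>(deriv ^^ k) (\<lambda>x. a * \<phi> x + b * \<eta> x) x\<bar> \<le>
          \<bar>a\<bar> * \<bar>(deriv ^^ k) \<phi> x\<bar> + \<bar>b\<bar> * \<bar>(deriv ^^ k) \<eta> x\<bar>"
        unfolding iterated_deriv_linear[OF C k] abs_mult[symmetric] by (rule abs_triangle_ineq)
      also have "\<dots> \<le> \<bar>a\<bar> * (A * (1 + \<bar>x\<bar>) powi (- l)) + \<bar>b\<bar> * (B * (1 + \<bar>x\<bar>) powi (- l))"
        by (intro add_mono mult_left_mono A B) auto
      also have "\<dots> \<le> (\<bar>a\<bar> * A + \<bar>b\<bar> * B + 1) * (1 + \<bar>x\<bar>) powi (- l)"
        by (simp add: algebra_simps)
      finally show ?thesis .
    qed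
    moreover have "0 < \<bar>a\<bar> * A + \<bar>b\<bar> * B + 1" using A B by (intro add_nonneg_pos add_nonneg_nonneg) auto
    ultimately show ?thesis by blast
  qed
  then show ?thesis using C_class_linear[OF C] by (simp add: S_space_def)
qed

section \<open>Functionals given by L_p functions\<close>

lemma S_space_Lp_integrable:
  assumes f: "f \<in> Lp p" and p: "1 \<le> p" and \<phi>: "\<phi> \<in> S_space r"
  shows "integrable lebesgue (\<lambda>x. f x * \<phi> x)"
proof -
  have c: "continuous_on UNIV \<phi>" using C_class_iterated_deriv(2)[of \<phi> r 0] \<phi> by (simp add: S_space_def)
  have "\<forall>l::int. \<exists>C>0. \<forall>x. \<bar>(deriv ^^ 0) \<phi> x\<bar> \<le> C * (1 + \<bar>x\<bar>) powi (- l)"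
    using \<phi> unfolding S_space_def by blast
  \<comment> \<open>Decay of order l = 2 provides an integrable and bounded majorant.\<close>
  then obtain C where C: "0 < C" "\<And>x. \<bar>\<phi> x\<bar> \<le> C * (1 + \<bar>x\<bar>) powi (- 2)" by force
  show ?thesis
  proof (rule Lp_mult_integrable[OF f p continuous_lebesgue_measurable[OF c]])
    show "integrable lebesgue (\<lambda>x. C * inverse ((1 + \<bar>x\<bar>)\<^sup>2))"
      by (intro integrable_mult_right integrable_inverse_square_weight)
    show "\<bar>\<phi> x\<bar> \<le> C * inverse ((1 + \<bar>x\<bar>)\<^sup>2)" for x
      using C(2)[of x] by (simp add: power_int_def power_inverse)
    have "inverse ((1 + \<bar>x\<bar>)\<^sup>2) \<le> 1" for x :: real
      by (simp add: inverse_le_1_iff one_le_power)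
    then show "C * inverse ((1 + \<bar>x\<bar>)\<^sup>2) \<le> C" for x using C(1) by simp
  qed
qed

text \<open>Continuity comes from a single weighted supremum norm: f is integrable against (1 +
  |x|)^(-2), so uniform smallness of (1 + |x|)^2 times the difference controls the pairing.\<close>

lemma regular_distribution_in_S_dual:
  assumes f: "f \<in> Lp p" and p: "1 \<le> p"
  shows "regular_distribution r f \<in> S_dual r"
proof -
  let ?\<Lambda> = "regular_distribution r f"
  let ?w = "\<lambda>x::real. inverse ((1 + \<bar>x\<bar>)\<^sup>2)"
  note i = S_space_Lp_integrable[OF f p]
  have lin: "?\<Lambda> (\<lambda>x. a * \<phi> x + b * \<eta> x) = a * ?\<Lambda> \<phi> + b * ?\<Lambda> \<eta>"
    if \<phi>: "\<phi> \<in> S_space r" and \<eta>: "\<eta> \<in> S_space r" for \<phi> \<eta> a b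
  proof -
    have "(LINT x|lebesgue. f x * (a * \<phi> x + b * \<eta> x)) =
        (LINT x|lebesgue. a * (f x * \<phi> x) + b * (f x * \<eta> x))"
      by (simp add: algebra_simps)
    also have "\<dots> = a * (LINT x|lebesgue. f x * \<phi> x) + b * (LINT x|lebesgue. f x * \<eta> x)"
      by (subst Bochner_Integration.integral_add) (auto intro!: integrable_mult_right i \<phi> \<eta>)
    \<comment> \<open>The functional is extensional: it evaluates as an integral only once the
      combination is known to lie in the test space.\<close>
    finally show ?thesis using S_space_linear[OF \<phi> \<eta>] \<phi> \<eta> by (simp add: regular_distribution_def)
  qed
  have cont: "(\<lambda>i. ?\<Lambda> (\<Phi> i)) \<longlonglongrightarrow> ?\<Lambda> \<phi>"
    if \<Phi>: "\<And>i. \<Phi> i \<in> S_space r" and \<phi>: "\<phi> \<in> S_space r" and conv: "S_converges r \<Phi> \<phi>" for \<Phi> \<phi>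
  proof (rule LIMSEQ_I)
    fix e :: real assume e: "0 < e"
    have "?w x \<le> 1" for x by (simp add: inverse_le_1_iff one_le_power)
    then have "integrable lebesgue (\<lambda>x. f x * ?w x)"
      by (intro Lp_mult_integrable[OF f p _ integrable_inverse_square_weight, where B = 1]
          continuous_lebesgue_measurable continuous_intros) auto
    from integrable_abs[OF this] have iw: "integrable lebesgue (\<lambda>x. \<bar>f x\<bar> * ?w x)" by (simp add: abs_mult)
    define J where "J = (LINT x|lebesgue. \<bar>f x\<bar> * ?w x)"
    have J: "0 \<le> J" by (simp add: J_def)
    \<comment> \<open>The summand 1 allows for J = 0.\<close>
    define d where "d = e / (J + 1)"
    have d: "0 < d" "d * J < e" using J e by (auto simp: d_def field_simps add_nonneg_pos)
    have "uniform_limit UNIV (\<lambda>i x. (1 + \<bar>x\<bar>) powi 2 * (deriv ^^ 0) (\<Phi> i) x)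
        (\<lambda>x. (1 + \<bar>x\<bar>) powi 2 * (deriv ^^ 0) \<phi> x) sequentially"
      using conv unfolding S_converges_def by blast
    from uniform_limitD[OF this d(1)] obtain N where
      N: "\<And>k x. N \<le> k \<Longrightarrow> \<bar>(1 + \<bar>x\<bar>)\<^sup>2 * \<Phi> k x - (1 + \<bar>x\<bar>)\<^sup>2 * \<phi> x\<bar> < d"
      by (auto simp: eventually_sequentially dist_real_def power_int_def)
    have "norm (?\<Lambda> (\<Phi> k) - ?\<Lambda> \<phi>) < e" if k: "N \<le> k" for k
    proof -
      have i2: "integrable lebesgue (\<lambda>x. f x * \<Phi> k x - f x * \<phi> x)"
        by (rule Bochner_Integration.integrable_diff[OF i[OF \<Phi>] i[OF \<phi>]])
      have "?\<Lambda> (\<Phi> k) - ?\<Lambda> \<phi> = (LINT x|lebesgue. f x * \<Phi> k x - f x * \<phi> x)"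
        using \<Phi> \<phi> by (simp add: regular_distribution_def Bochner_Integration.integral_diff[OF i[OF \<Phi>] i[OF \<phi>]])
      also have "norm \<dots> \<le> (LINT x|lebesgue. norm (f x * \<Phi> k x - f x * \<phi> x))"
        by (rule integral_norm_bound)
      also have "\<dots> \<le> (LINT x|lebesgue. d * (\<bar>f x\<bar> * ?w x))"
      proof (intro integral_mono integrable_norm i2 integrable_mult_right iw)
        fix x
        have "(1 + \<bar>x\<bar>)\<^sup>2 * \<bar>\<Phi> k x - \<phi> x\<bar> \<le> d"
          using N[OF k, of x] by (simp add: right_diff_distrib[symmetric] abs_mult)
        then have "\<bar>\<Phi> k x - \<phi> x\<bar> \<le> d * ?w x"
          by (simp add: field_simps add_pos_nonneg)
        from mult_left_mono[OF this, of "\<bar>f x\<bar>"]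
        show "norm (f x * \<Phi> k x - f x * \<phi> x) \<le> d * (\<bar>f x\<bar> * ?w x)"
          unfolding right_diff_distrib[symmetric] real_norm_def abs_mult by (simp add: mult.left_commute)
      qed
      also have "\<dots> = d * J" by (simp add: J_def)
      finally show ?thesis using d(2) by linarith
    qed
    then show "\<exists>N. \<forall>k\<ge>N. norm (?\<Lambda> (\<Phi> k) - ?\<Lambda> \<phi>) < e" by blast
  qed
  have "?\<Lambda> \<in> extensional (S_space r)" by (simp add: regular_distribution_def)
  then show ?thesis unfolding S_dual_def using lin cont by blast
qed

text \<open>Exchanging the centre b for b' costs exp(\<gamma> \<delta>). This carries the
  half-integer shifts to integer points, where the discrete norm estimate applies.\<close>

lemma abs_integral_exp_decaying_le:
  assumes g: "g \<in> Lp p" and p: "1 \<le> p" and C: "0 \<le> C" "0 < \<gamma>" "\<And>x. \<bar>\<theta> x\<bar> \<le> C * exp (- \<gamma> * \<bar>x\<bar>)"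
    and c: "continuous_on UNIV \<theta>" and a: "a \<noteq> 0" and d: "\<bar>b - b'\<bar> \<le> \<delta>"
  shows "\<bar>LINT x|lebesgue. g x * \<theta> (a * x - b)\<bar> \<le>
    C * exp (\<gamma> * \<delta>) * (LINT x|lebesgue. \<bar>g x\<bar> * exp (- \<gamma> * \<bar>a * x - b'\<bar>))"
proof -
  have le: "exp (- \<gamma> * \<bar>y\<bar>) \<le> 1" for y using C by simp
  have ig: "integrable lebesgue (\<lambda>x. g x * exp (- \<gamma> * \<bar>a * x - b'\<bar>))"
    by (rule Lp_mult_integrable[OF g p _ integrable_exp_abs_affine[OF C(2) a], where B = 1])
      (use le in \<open>auto intro!: continuous_lebesgue_measurable continuous_intros\<close>)
  from integrable_abs[OF this] have ig: "integrable lebesgue (\<lambda>x. \<bar>g x\<bar> * exp (- \<gamma> * \<bar>a * x - b'\<bar>))"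
    by (simp add: abs_mult)
  have bnd: "\<bar>\<theta> (a * x - b)\<bar> \<le> C * exp (\<gamma> * \<delta>) * exp (- \<gamma> * \<bar>a * x - b'\<bar>)" for x
  proof -
    have "\<bar>a * x - b'\<bar> \<le> \<bar>a * x - b\<bar> + \<delta>" using d by linarith
    then have "\<gamma> * \<bar>a * x - b'\<bar> \<le> \<gamma> * (\<bar>a * x - b\<bar> + \<delta>)" using C by (intro mult_left_mono) auto
    then have "exp (- \<gamma> * \<bar>a * x - b\<bar>) \<le> exp (\<gamma> * \<delta>) * exp (- \<gamma> * \<bar>a * x - b'\<bar>)"
      unfolding exp_add[symmetric] by (simp add: algebra_simps)
    from mult_left_mono[OF this C(1)] C(3)[of "a * x - b"] show ?thesis by simp
  qed
  have "integrable lebesgue (\<lambda>x. g x * \<theta> (a * x - b))"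
  proof (rule Lp_mult_integrable[OF g p])
    show "(\<lambda>x. \<theta> (a * x - b)) \<in> borel_measurable lebesgue"
      by (intro continuous_lebesgue_measurable continuous_on_compose2[OF c] continuous_intros) auto
    show "integrable lebesgue (\<lambda>x. C * exp (- \<gamma> * \<bar>a * x - b\<bar>))"
      by (intro integrable_mult_right integrable_exp_abs_affine C a)
    show "C * exp (- \<gamma> * \<bar>a * x - b\<bar>) \<le> C" for x
      using mult_left_mono[OF le C(1)] by simp
  qed (rule C(3))
  have "\<bar>LINT x|lebesgue. g x * \<theta> (a * x - b)\<bar> \<le> (LINT x|lebesgue. \<bar>g x * \<theta> (a * x - b)\<bar>)"
    by (rule integral_abs_bound)
  also have "\<dots> \<le> (LINT x|lebesgue. C * exp (\<gamma> * \<delta>) * (\<bar>g x\<bar> * exp (- \<gamma> * \<bar>a * x - b'\<bar>)))"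
  proof (intro integral_mono integrable_mult_right ig)
    show "integrable lebesgue (\<lambda>x. \<bar>g x * \<theta> (a * x - b)\<bar>)"
      by (intro integrable_abs) fact
    show "\<bar>g x * \<theta> (a * x - b)\<bar> \<le> C * exp (\<gamma> * \<delta>) * (\<bar>g x\<bar> * exp (- \<gamma> * \<bar>a * x - b'\<bar>))" for x
      using mult_left_mono[OF bnd[of x], of "\<bar>g x\<bar>"] by (simp add: abs_mult mult_ac)
  qed
  finally show ?thesis by simp
qed

section \<open>Uniform bound over all levels j\<close>

theorem proposition1p5:
  fixes n :: nat and p :: ennreal and \<psi> \<Psi> :: "real \<Rightarrow> real"
  assumes "n \<ge> 1" and "battle_lemarie_system n \<psi> \<Psi>" and "1 \<le> p"
  shows "\<exists>C::real. C > 0 \<and>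
    (\<forall>f \<in> sobolev (n + 1) p.
      regular_distribution (n - 1) f \<in> BL_space n p \<psi> \<Psi> \<and>
      BL_norm n p \<psi> \<Psi> (regular_distribution (n - 1) f) \<le> ennreal C * sobolev_norm (n + 1) p f)"
proof -
  note p = \<open>1 \<le> p\<close>
  define s where "s = enn2real (1 / p)"
  \<comment> \<open>This makes the exponent n + 1 - 1/p nonnegative, as the level j = -1
    requires.\<close>
  have s: "s \<le> 1"
  proof (cases "p = top")
    case False
    then show ?thesis using enn2real_ge_1[OF p] by (simp add: s_def enn2real_inverse[OF p])
  qed (simp add: s_def)
  have cl: "\<psi> \<in> C_class (n - 1)" "\<Psi> \<in> C_class (n - 1)"
    and mom: "\<And>\<kappa>. \<kappa> \<le> n \<Longrightarrow> (LINT x|lebesgue. x ^ \<kappa> * \<psi> x) = 0"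
    using assms(2) by (auto simp: battle_lemarie_system_def)
  have "\<exists>C0>0. \<exists>\<gamma>>0. \<forall>k\<le>n - 1. \<forall>x.
      \<bar>(deriv ^^ k) \<Psi> x\<bar> + \<bar>(deriv ^^ k) \<psi> x\<bar> \<le> C0 * exp (- \<gamma> * \<bar>x\<bar>)"
    using assms(2) unfolding battle_lemarie_system_def by (elim conjE)
  then obtain C0 \<gamma> where C0: "0 < C0" "0 < \<gamma>" and "\<forall>k\<le>n - 1. \<forall>x.
      \<bar>(deriv ^^ k) \<Psi> x\<bar> + \<bar>(deriv ^^ k) \<psi> x\<bar> \<le> C0 * exp (- \<gamma> * \<bar>x\<bar>)"
    by (elim exE conjE) (rule that)
  note b = this(3)[rule_format]
  have b\<Psi>: "\<bar>(deriv ^^ k) \<Psi> x\<bar> \<le> C0 * exp (- \<gamma> * \<bar>x\<bar>)"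
    and b\<psi>: "\<bar>(deriv ^^ k) \<psi> x\<bar> \<le> C0 * exp (- \<gamma> * \<bar>x\<bar>)" if "k \<le> n - 1" for k x
    using b[OF that, of x] by linarith+
  have cont: "continuous_on UNIV \<psi>" "continuous_on UNIV \<Psi>"
    using C_class_iterated_deriv(2)[OF cl(1), of 0] C_class_iterated_deriv(2)[OF cl(2), of 0] by auto
  have dec: "exp_decaying \<psi>" using cont C0 b\<psi>[of 0] unfolding exp_decaying_def by auto
  \<comment> \<open>The moments of orders 0 to n are n + 1 in number, one for each derivative to be
    transferred to f.\<close>
  have "\<exists>\<theta>. exp_decaying \<theta> \<and> (\<forall>h p a b. 1 \<le> p \<longrightarrow> a \<noteq> 0 \<longrightarrow> (\<forall>i\<le>n + 1. h i \<in> Lp p) \<longrightarrow>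
      (\<forall>i<n + 1. has_weak_deriv 1 (h i) (h (Suc i))) \<longrightarrow>
      (LINT x|lebesgue. h 0 x * \<psi> (a * x - b)) =
        (- (1 / a)) ^ (n + 1) * (LINT x|lebesgue. h (n + 1) x * \<theta> (a * x - b)))"
    by (rule vanishing_moments_pairing[OF dec]) (simp add: mom)
  then obtain \<theta> where \<theta>: "exp_decaying \<theta>"
    and pairs: "\<forall>h p a b. 1 \<le> p \<longrightarrow> a \<noteq> 0 \<longrightarrow> (\<forall>i\<le>n + 1. h i \<in> Lp p) \<longrightarrow>
      (\<forall>i<n + 1. has_weak_deriv 1 (h i) (h (Suc i))) \<longrightarrow>
      (LINT x|lebesgue. h 0 x * \<psi> (a * x - b)) =
        (- (1 / a)) ^ (n + 1) * (LINT x|lebesgue. h (n + 1) x * \<theta> (a * x - b))"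
    by (elim exE conjE) (rule that)
  have pairing: "(LINT x|lebesgue. h 0 x * \<psi> (a * x - c)) =
        (- (1 / a)) ^ (n + 1) * (LINT x|lebesgue. h (n + 1) x * \<theta> (a * x - c))"
    if "a \<noteq> 0" "\<forall>i\<le>n + 1. h i \<in> Lp p" "\<forall>i<n + 1. has_weak_deriv 1 (h i) (h (Suc i))" for h a c
    using pairs[THEN spec[of _ h], THEN spec[of _ p], THEN spec[of _ a], THEN spec[of _ c]] p that
    by (elim impE)
  \<comment> \<open>\<theta> has a decay rate of its own, so the discrete estimate is invoked twice:
    with \<gamma> for \<open>\<Psi>\<close> and with \<delta> for \<open>\<theta>\<close>.\<close>
  obtain C1 \<delta> where C1: "0 < C1" "0 < \<delta>" "\<And>x. \<bar>\<theta> x\<bar> \<le> C1 * exp (- \<delta> * \<bar>x\<bar>)"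
    and c\<theta>: "continuous_on UNIV \<theta>"
    using \<theta> unfolding exp_decaying_def by blast
  obtain K0 where K0_pos: "0 < K0" and "\<forall>a>0. \<forall>D\<ge>0. \<forall>g\<in>Lp p. \<forall>u.
      (\<forall>\<mu>::int. \<bar>u \<mu>\<bar> \<le> D * (a * (LINT x|lebesgue. \<bar>g x\<bar> * exp (- \<gamma> * \<bar>a * x - of_int \<mu>\<bar>)))) \<longrightarrow>
      lp_norm p u \<le> ennreal (K0 * D * a powr s) * Lp_norm p g"
    using lp_norm_exp_average_le[OF C0(2) p, folded s_def] by (elim exE conjE) (rule that)
  note K0 = this(2)[rule_format]
  obtain K1 where K1_pos: "0 < K1" and "\<forall>a>0. \<forall>D\<ge>0. \<forall>g\<in>Lp p. \<forall>u.
      (\<forall>\<mu>::int. \<bar>u \<mu>\<bar> \<le> D * (a * (LINT x|lebesgue. \<bar>g x\<bar> * exp (- \<delta> * \<bar>a * x - of_int \<mu>\<bar>)))) \<longrightarrow>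
      lp_norm p u \<le> ennreal (K1 * D * a powr s) * Lp_norm p g"
    using lp_norm_exp_average_le[OF C1(2) p, folded s_def] by (elim exE conjE) (rule that)
  note K1 = this(2)[rule_format]
  \<comment> \<open>The first summand serves j = -1, the second all j \<ge> 0: the 2 counts the
    shifts 2\<mu> and 2\<mu> + 1, and exp(\<delta>/2) pays for moving a centre by at most
    1/2.\<close>
  define C where "C = K0 * C0 + 2 * K1 * C1 * exp (\<delta> / 2)"
  have pos: "0 < K0 * C0" "0 < 2 * K1 * C1 * exp (\<delta> / 2)" using K0_pos K1_pos C0 C1 by auto
  have C: "0 < C" unfolding C_def by (rule add_pos_pos[OF pos])
  have in_S: "(\<lambda>x. \<psi> (a * x - c)) \<in> S_space (n - 1)" "(\<lambda>x. \<Psi> (a * x - c)) \<in> S_space (n - 1)" if "a \<noteq> 0" for a c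
    using S_space_affine[OF cl(1) that _ C0(2) b\<psi>] S_space_affine[OF cl(2) that _ C0(2) b\<Psi>] C0(1) by auto
  \<comment> \<open>The bound is proved for every weak derivative \<open>g\<close> in L_p, since
    \<open>weak_deriv\<close> is an unspecified choice.\<close>
  have main: "BL_norm n p \<psi> \<Psi> (regular_distribution (n - 1) f) \<le> ennreal C * (Lp_norm p f + Lp_norm p g)"
    if f: "f \<in> sobolev (n + 1) p" and g: "g \<in> Lp p" and fg: "has_weak_deriv (n + 1) f g" for f g
  proof -
    let ?\<Lambda> = "regular_distribution (n - 1) f"
    have fL: "f \<in> Lp p" using f by (simp add: sobolev_def)
    have "\<forall>i. \<exists>G. i \<le> n + 1 \<longrightarrow> G \<in> Lp p \<and> has_weak_deriv i f G"
      using f by (auto simp: sobolev_def)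
    from choice[OF this] obtain G where G: "\<And>i. i \<le> n + 1 \<Longrightarrow> G i \<in> Lp p \<and> has_weak_deriv i f (G i)" by blast
    \<comment> \<open>Patching both ends makes the chain start at f itself and end at the prescribed
      g.\<close>
    define h where "h = G(0 := f, n + 1 := g)"
    have "has_weak_deriv 0 f f" using fg by (simp add: has_weak_deriv_def)
    then have h: "h i \<in> Lp p" "has_weak_deriv i f (h i)" if "i \<le> n + 1" for i
      using G[OF that] fL g fg by (auto simp: h_def)
    have h1: "has_weak_deriv 1 (h i) (h (Suc i))" if "i < n + 1" for i
      using has_weak_deriv_successive[of i f "h i" "h (Suc i)"] h(2)[of i] h(2)[of "Suc i"] that by simp
    have pair: "(LINT x|lebesgue. f x * \<psi> (a * x - c)) =
        (- (1 / a)) ^ (n + 1) * (LINT x|lebesgue. g x * \<theta> (a * x - c))" if "a \<noteq> 0" for a c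
      using pairing[OF that, of h c] h(1) h1 by (simp add: h_def)
    have "ennreal (2 powr (of_int j * (real n + 1 - s))) * lp_norm p (spline_coeff \<psi> \<Psi> ?\<Lambda> j)
        \<le> ennreal C * (Lp_norm p f + Lp_norm p g)" if j: "- 1 \<le> j" for j
    proof (cases "j = - 1")
      case True
      have "\<bar>spline_coeff \<psi> \<Psi> ?\<Lambda> j \<mu>\<bar> \<le>
          C0 * (1 * (LINT x|lebesgue. \<bar>f x\<bar> * exp (- \<gamma> * \<bar>1 * x - of_int \<mu>\<bar>)))" for \<mu>
      proof -
        have "?\<Lambda> (\<lambda>x. \<Psi> (1 * x - of_int \<mu>)) = (LINT x|lebesgue. f x * \<Psi> (1 * x - of_int \<mu>))"
          using in_S(2)[of 1 "of_int \<mu>"] by (simp add: regular_distribution_def)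
        moreover have "\<bar>LINT x|lebesgue. f x * \<Psi> (1 * x - of_int \<mu>)\<bar> \<le>
            C0 * exp (\<gamma> * 0) * (LINT x|lebesgue. \<bar>f x\<bar> * exp (- \<gamma> * \<bar>1 * x - of_int \<mu>\<bar>))"
          using b\<Psi>[of 0] C0 by (intro abs_integral_exp_decaying_le[OF fL p _ C0(2) _ cont(2)]) auto
        ultimately show ?thesis
          using True by (simp add: spline_coeff_def shifted_system_def[abs_def])
      qed
      from K0[OF zero_less_one less_imp_le[OF C0(1)] fL this]
      have "lp_norm p (spline_coeff \<psi> \<Psi> ?\<Lambda> j) \<le> ennreal (K0 * C0) * Lp_norm p f" by simp
      \<comment> \<open>At j = -1 the weight is 2 to a nonpositive power.\<close>
      moreover have "ennreal (2 powr (of_int j * (real n + 1 - s))) \<le> 1"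
        using s True powr_mono[of "- (real n + 1 - s)" 0 2]
        by (simp add: ennreal_le_1)
      ultimately have "ennreal (2 powr (of_int j * (real n + 1 - s))) * lp_norm p (spline_coeff \<psi> \<Psi> ?\<Lambda> j) \<le>
          1 * (ennreal (K0 * C0) * Lp_norm p f)"
        by (intro mult_mono) auto
      also have "\<dots> \<le> ennreal C * (Lp_norm p f + Lp_norm p g)"
        unfolding mult_1 using pos by (intro mult_mono ennreal_leI) (auto simp: C_def add_increasing2)
      finally show ?thesis .
    next
      case False
      with j have j0: "0 \<le> j" by simp
      define a :: real where "a = 2 powi j"
      have a: "0 < a" by (simp add: a_def)
      have apowr: "a powr t = 2 powr (of_int j * t)" for t
        by (simp add: a_def powr_real_of_int' powr_powr[symmetric])
      define I where "I \<mu> = (LINT x|lebesgue. \<bar>g x\<bar> * exp (- \<delta> * \<bar>a * x - of_int \<mu>\<bar>))" for \<mu> :: int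
      \<comment> \<open>For \<nu> = 2\<mu> the centre \<nu>/2 is \<mu>, for \<nu> = 2\<mu> + 1 it is
        \<mu> + 1/2, so both shifts are compared with the same integer.\<close>
      have each: "\<bar>?\<Lambda> (shifted_system \<psi> \<Psi> j \<nu>)\<bar> \<le> (1 / a) ^ (n + 1) * (C1 * exp (\<delta> / 2) * I \<mu>)"
        if \<nu>: "\<bar>of_int \<nu> / 2 - of_int \<mu>\<bar> \<le> (1 / 2 :: real)" for \<mu> \<nu>
      proof -
        have "?\<Lambda> (shifted_system \<psi> \<Psi> j \<nu>) = (LINT x|lebesgue. f x * \<psi> (a * x - of_int \<nu> / 2))"
          using in_S(1)[of a "of_int \<nu> / 2"] a False
          by (simp add: regular_distribution_def shifted_system_def[abs_def] a_def)
        also have "\<dots> = (- (1 / a)) ^ (n + 1) * (LINT x|lebesgue. g x * \<theta> (a * x - of_int \<nu> / 2))"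
          using a by (intro pair) auto
        finally have "\<bar>?\<Lambda> (shifted_system \<psi> \<Psi> j \<nu>)\<bar> =
            (1 / a) ^ (n + 1) * \<bar>LINT x|lebesgue. g x * \<theta> (a * x - of_int \<nu> / 2)\<bar>"
          using a by (simp add: abs_mult power_abs)
        also have "\<dots> \<le> (1 / a) ^ (n + 1) * (C1 * exp (\<delta> * (1 / 2)) * I \<mu>)"
          unfolding I_def using C1 a \<nu>
          by (intro mult_left_mono abs_integral_exp_decaying_le[OF g p _ C1(2,3) c\<theta>]) auto
        finally show ?thesis by simp
      qed
      \<comment> \<open>The factor 2^j of the coefficient is kept out of D: it normalises the
        average in the discrete estimate.\<close>
      define D where "D = 2 * (1 / a) ^ (n + 1) * (C1 * exp (\<delta> / 2))"
      have D: "0 \<le> D" using a C1 by (simp add: D_def)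
      have "\<bar>spline_coeff \<psi> \<Psi> ?\<Lambda> j \<mu>\<bar> \<le> D * (a * I \<mu>)" for \<mu>
      proof -
        have "\<bar>spline_coeff \<psi> \<Psi> ?\<Lambda> j \<mu>\<bar> =
            a * (\<bar>?\<Lambda> (shifted_system \<psi> \<Psi> j (2 * \<mu>))\<bar> + \<bar>?\<Lambda> (shifted_system \<psi> \<Psi> j (2 * \<mu> + 1))\<bar>)"
          using False a by (simp add: spline_coeff_def a_def[symmetric] distrib_left)
        also have "\<dots> \<le> a * ((1 / a) ^ (n + 1) * (C1 * exp (\<delta> / 2) * I \<mu>) +
            (1 / a) ^ (n + 1) * (C1 * exp (\<delta> / 2) * I \<mu>))"
          using a by (intro mult_left_mono add_mono each) (auto simp: add_divide_distrib)
        also have "\<dots> = D * (a * I \<mu>)" by (simp add: D_def)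
        finally show ?thesis .
      qed
      from K1[OF a D g this[unfolded I_def]]
      have "ennreal (a powr (real n + 1 - s)) * lp_norm p (spline_coeff \<psi> \<Psi> ?\<Lambda> j) \<le>
          ennreal (a powr (real n + 1 - s)) * (ennreal (K1 * D * a powr s) * Lp_norm p g)"
        by (intro mult_left_mono) auto
      also have "\<dots> = ennreal (a powr (real n + 1 - s) * (K1 * D * a powr s)) * Lp_norm p g"
        using K1_pos D by (simp add: ennreal_mult mult.assoc)
      \<comment> \<open>The powers of a cancel: n + 1 - s from the weight, s from the discrete
        estimate and -(n + 1) inside D.\<close>
      also have "a powr (real n + 1 - s) * (K1 * D * a powr s) = 2 * K1 * C1 * exp (\<delta> / 2)"
      proof -
        have "a powr (real n + 1 - s) * a powr s = a powr (real (n + 1))"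
          by (simp add: powr_add[symmetric] add.commute)
        also have "\<dots> = a ^ (n + 1)" using a by (rule powr_realpow)
        finally have "a powr (real n + 1 - s) * (K1 * D * a powr s) = K1 * D * a ^ (n + 1)"
          by (simp add: mult_ac)
        also have "\<dots> = 2 * K1 * (C1 * exp (\<delta> / 2)) * ((1 / a) * a) ^ (n + 1)"
          unfolding D_def power_mult_distrib by simp
        finally show ?thesis using a by simp
      qed
      also have "ennreal (2 * K1 * C1 * exp (\<delta> / 2)) * Lp_norm p g \<le> ennreal C * (Lp_norm p f + Lp_norm p g)"
        using pos by (intro mult_mono ennreal_leI) (auto simp: C_def add_increasing)
      finally show ?thesis by (simp add: apowr)
    qed
    then show ?thesis by (auto simp: BL_norm_def s_def intro!: SUP_least)
  qed
  have "regular_distribution (n - 1) f \<in> BL_space n p \<psi> \<Psi> \<and>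
      BL_norm n p \<psi> \<Psi> (regular_distribution (n - 1) f) \<le> ennreal C * sobolev_norm (n + 1) p f"
    if f: "f \<in> sobolev (n + 1) p" for f
  proof
    have fL: "f \<in> Lp p" using f by (simp add: sobolev_def)
    obtain g where g: "g \<in> Lp p" "has_weak_deriv (n + 1) f g" using f by (auto simp: sobolev_def)
    have "Lp_norm p f + Lp_norm p g < top" using fL g by (simp add: Lp_def)
    then have "ennreal C * (Lp_norm p f + Lp_norm p g) < top" by (simp add: ennreal_mult_less_top)
    with main[OF f g] have "BL_norm n p \<psi> \<Psi> (regular_distribution (n - 1) f) < top" by (rule le_less_trans)
    then show "regular_distribution (n - 1) f \<in> BL_space n p \<psi> \<Psi>"
      using regular_distribution_in_S_dual[OF fL p] by (simp add: BL_space_def)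
    have w: "has_weak_deriv (n + 1) f (weak_deriv (n + 1) f)"
      unfolding weak_deriv_def by (rule someI[of "has_weak_deriv (n + 1) f", OF g(2)])
    show "BL_norm n p \<psi> \<Psi> (regular_distribution (n - 1) f) \<le> ennreal C * sobolev_norm (n + 1) p f"
    \<comment> \<open>If the chosen derivative had infinite norm, the right side would be infinite
      as C > 0. The case split replaces an appeal to almost everywhere uniqueness of weak
      derivatives.\<close>
    proof (cases "Lp_norm p (weak_deriv (n + 1) f) = top")
      case True
      then show ?thesis using C by (simp add: sobolev_norm_def ennreal_mult_top)
    next
      case False
      then have "weak_deriv (n + 1) f \<in> Lp p"
        using w by (auto simp: Lp_def has_weak_deriv_def less_top intro: locally_integrable_imp_measurable)
      from main[OF f this w] show ?thesis by (simp add: sobolev_norm_def)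
    qed
  qed
  with C show ?thesis by blast
qed

end
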